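(* Let $k>0$, $b>0$, and suppose that $C=A=B$. Consider the time-optimal problem with the state constraint $y\ge kx-b$. Then the optimal synthesis is as follows. (i) For starting points in $W_1$ the optimal trajectories are the same as in the free problem (the problem without the state constraint). (ii) For starting points in $\operatorname{int}W_2$ an optimal trajectory is of the following type $N'NCO$, with control $u=(-1,\,ky,\,+1)$: it moves with $u=-1$ from the starting point $N'$ to a point $N$ of the open line interval $(C,E)\subset\Gamma$, then along $\Gamma$ with $u=ky$ from $N$ to $C$, and then with $u=+1$ from $C$ to the origin $O$. (iii) For starting points lying on the open interval $(C,E)$ of $\Gamma$, the optimal trajectories are the tails of optimal trajectories starting from $\operatorname{int}W_2$ whose first leg is the motion with $u=-1$ to a point on $(C,E)$.
   Context: Problem: on $[0,T]$ with $T$ free, $\dot x=y$, $\dot y=u$, $x(0)=x_0$, $y(0)=y_0$, $x(T)=0$, $y(T)=0$, $|u|\le 1$, $T\to\min$, under the state constraint $y\ge kx-b$ on $[0,T]$. Controls $u$ are measurable; $x,y$ are Lipschitz. The free problem is the same problem without the state constraint. $O=(0,0)$. $\Gamma$ is the line $y=kx-b$. $S$ is the switching curve of the free problem, the union of the semi-parabolas $x=-\tfrac12y^2,\ y\ge0$ and $x=\tfrac12y^2,\ y\le0$. Characteristic points: $A=(x_A,y_A)$ is the intersection of $\Gamma$ and $S$, with $y_A=\frac{1-\sqrt{2bk+1}}{k}$, $x_A=\frac12y_A^2$; $E=(b/k,0)$; $C$ is the point where $\Gamma$ is tangent to a parabola of the family $x=-\frac12y^2+\mathrm{const}$, namely $C=\left(\frac{kb-1}{k^2},-\frac1k\right)$,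 the tangent parabola being $x=-\frac12y^2+m$ with $m=\frac{2kb-1}{2k^2}$; $B=(m/2,-\sqrt m)$ is the intersection of this tangent parabola with $S$. Sets: $W_1$ is the closed set of points on the left of $\Gamma$ and of the arc $x=-\frac12y^2+m$, $y\ge -1/k$: that is, all $(x,y)$ with $y\ge kx-b$ and, if $y\ge-1/k$, also $x\le -\frac12y^2+m$. $W_2$ is the closed set bounded by the arc $x=-\frac12y^2+m$ ($y\ge-1/k$), the arc $x=-\frac12y^2+\frac bk$ ($y\ge0$) and the segment $[C,E]$ of $\Gamma$: that is, all $(x,y)$ with $y\ge-1/k$, $x\ge m-\frac12y^2$, and $x\le\frac bk-\frac12y^2$ if $y\ge0$, $x\le\frac{y+b}{k}$ if $-1/k\le y\le0$. *)

theory Defs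
  imports "HOL-Analysis.Analysis"
begin

text \<open>Controlled motions of the double integrator from \<open>p\<close> to the origin on the time
  interval \<open>[0,T]\<close>. All conditions depend only on the restrictions of \<open>x\<close>, \<open>y\<close>, \<open>u\<close> to
  \<open>[0,T]\<close>; \<open>T = 0\<close> is allowed, so that the origin itself is a legitimate starting point.
  The state constraint is given by a set \<open>K\<close> of permitted states.\<close>

definition admissible ::
  "(real \<times> real) set \<Rightarrow> real \<times> real \<Rightarrow> real \<Rightarrow> (real \<Rightarrow> real) \<Rightarrow> (real \<Rightarrow> real) \<Rightarrow> (real \<Rightarrow> real) \<Rightarrow> bool"
  where
  "admissible K p T x y u \<longleftrightarrow>
     0 \<le> T \<and>
     (\<exists>L. L-lipschitz_on {0..T} x) \<and>
     (\<exists>L. L-lipschitz_on {0..T} y) \<and>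
     u \<in> borel_measurable (lebesgue_on {0..T}) \<and>
     (AE t in lebesgue_on {0..T}. (x has_real_derivative y t) (at t within {0..T})) \<and>
     (AE t in lebesgue_on {0..T}. (y has_real_derivative u t) (at t within {0..T})) \<and>
     (AE t in lebesgue_on {0..T}. \<bar>u t\<bar> \<le> 1) \<and>
     (x 0, y 0) = p \<and> (x T, y T) = (0, 0) \<and>
     (\<forall>t\<in>{0..T}. (x t, y t) \<in> K)"

definition optimal ::
  "(real \<times> real) set \<Rightarrow> real \<times> real \<Rightarrow> real \<Rightarrow> (real \<Rightarrow> real) \<Rightarrow> (real \<Rightarrow> real) \<Rightarrow> (real \<Rightarrow> real) \<Rightarrow> bool"
  where
  "optimal K p T x y u \<longleftrightarrow>
     admissible K p T x y u \<and>
     (\<forall>T' x' y' u'. admissible K p T' x' y' u' \<longrightarrow> T \<le> T')"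

abbreviation free_optimal where
  "free_optimal \<equiv> optimal UNIV"

definition constraint_set :: "real \<Rightarrow> real \<Rightarrow> (real \<times> real) set" where
  "constraint_set k b = {(x, y). y \<ge> k * x - b}"

definition Gamma_line :: "real \<Rightarrow> real \<Rightarrow> (real \<times> real) set" where
  "Gamma_line k b = {(x, y). y = k * x - b}"

definition switching_curve :: "(real \<times> real) set" where
  "switching_curve = {(x, y). (x = - y\<^sup>2 / 2 \<and> y \<ge> 0) \<or> (x = y\<^sup>2 / 2 \<and> y \<le> 0)}"

definition parabola :: "real \<Rightarrow> (real \<times> real) set" where
  "parabola c = {(x, y). x = - y\<^sup>2 / 2 + c}"

definition m_const :: "real \<Rightarrow> real \<Rightarrow> real" where
  "m_const k b = (2 * k * b - 1) / (2 * k\<^sup>2)"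

definition point_A :: "real \<Rightarrow> real \<Rightarrow> real \<times> real" where
  "point_A k b = (let yA = (1 - sqrt (2 * b * k + 1)) / k in (yA\<^sup>2 / 2, yA))"

definition point_B :: "real \<Rightarrow> real \<Rightarrow> real \<times> real" where
  "point_B k b = (m_const k b / 2, - sqrt (m_const k b))"

definition point_C :: "real \<Rightarrow> real \<Rightarrow> real \<times> real" where
  "point_C k b = ((k * b - 1) / k\<^sup>2, - 1 / k)"

definition point_E :: "real \<Rightarrow> real \<Rightarrow> real \<times> real" where
  "point_E k b = (b / k, 0)"

text \<open>The formulas above describe the geometric objects they are meant to describe.\<close>

lemma Gamma_line_Int_switching_curve:
  assumes "k > 0" "b > 0"
  shows "Gamma_line k b \<inter> switching_curve = {point_A k b}"
proof -
  define s where "s = sqrt (2 * b * k + 1)"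
  have s2: "s\<^sup>2 = 2 * b * k + 1" and s1: "s > 1"
    using assms by (simp_all add: s_def)
  have A: "point_A k b = (((1 - s) / k)\<^sup>2 / 2, (1 - s) / k)"
    by (simp add: point_A_def Let_def s_def)
  have "point_A k b \<in> Gamma_line k b \<inter> switching_curve"
  proof -
    have "(1 - s) / k = k * (((1 - s) / k)\<^sup>2 / 2) - b"
      using assms s2 by (simp add: power_divide power2_diff divide_simps power2_eq_square)
        (simp add: algebra_simps)
    moreover have "(1 - s) / k \<le> 0"
      using assms s1 by (simp add: divide_simps)
    ultimately show ?thesis unfolding A by (simp add: Gamma_line_def switching_curve_def)
  qed
  moreover have "(x, y) = point_A k b" if "(x, y) \<in> Gamma_line k b \<inter> switching_curve" for x y
  proof -
    from that have y: "y = k * x - b"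
      and S: "(x = - y\<^sup>2 / 2 \<and> y \<ge> 0) \<or> (x = y\<^sup>2 / 2 \<and> y \<le> 0)"
      by (auto simp: Gamma_line_def switching_curve_def)
    have "\<not> (x = - y\<^sup>2 / 2 \<and> y \<ge> 0)"
    proof
      assume H: "x = - y\<^sup>2 / 2 \<and> y \<ge> 0"
      then have "k * x \<le> 0" using assms by (simp add: mult_nonneg_nonpos)
      then show False using y H assms by linarith
    qed
    with S have x: "x = y\<^sup>2 / 2" and y0: "y \<le> 0" by auto
    have "(k * y - 1)\<^sup>2 = s\<^sup>2"
      unfolding s2 using y x by algebra
    moreover have "k * y \<le> 0" using assms y0 by (simp add: mult_nonneg_nonpos)
    ultimately have "k * y = 1 - s" using s1 by (auto simp: power2_eq_iff)
    then have "y = (1 - s) / k" using assms by (simp add: field_simps)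
    then show ?thesis using x A by simp
  qed
  ultimately show ?thesis by auto
qed

text \<open>A single common point of a non-vertical line and a parabola with horizontal axis
  means tangency.\<close>

lemma Gamma_line_Int_parabola:
  assumes "k > 0"
  shows "Gamma_line k b \<inter> parabola (m_const k b) = {point_C k b}"
proof -
  have m: "2 * k\<^sup>2 * m_const k b = 2 * k * b - 1"
    using assms by (simp add: m_const_def)
  have C: "(x, y) = point_C k b \<longleftrightarrow> k\<^sup>2 * x = k * b - 1 \<and> k * y = - 1" for x y
    using assms by (auto simp: point_C_def eq_divide_eq eq_minus_divide_eq mult.commute)
  have "y = k * x - b \<and> x = - y\<^sup>2 / 2 + m_const k b \<longleftrightarrow> (x, y) = point_C k b" for x y
    unfolding C
  proof
    assume H: "y = k * x - b \<and> x = - y\<^sup>2 / 2 + m_const k b"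
    then have "k * x = y + b" by linarith
    then have a: "k\<^sup>2 * x = k * y + k * b"
      by (simp add: power2_eq_square distrib_left mult.assoc)
    have "2 * k\<^sup>2 * x = 2 * k\<^sup>2 * (- y\<^sup>2 / 2 + m_const k b)"
      by (rule arg_cong[OF conjunct2[OF H]])
    also have "\<dots> = 2 * k * b - 1 - (k * y)\<^sup>2"
      unfolding m[symmetric] by (simp add: power_mult_distrib algebra_simps)
    finally have "(k * y + 1)\<^sup>2 = 0"
      using a by (simp add: power2_sum)
    then have "k * y = - 1" by simp
    then show "k\<^sup>2 * x = k * b - 1 \<and> k * y = - 1"
      using a by simp
  next
    assume H: "k\<^sup>2 * x = k * b - 1 \<and> k * y = - 1"
    then have "k * y = k * (k * x - b)"
      by (simp add: power2_eq_square right_diff_distrib mult.assoc)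
    moreover have "(2 * k\<^sup>2) * x = (2 * k\<^sup>2) * (- y\<^sup>2 / 2 + m_const k b)"
    proof -
      have "k\<^sup>2 * y\<^sup>2 = 1" using H by (simp flip: power_mult_distrib)
      then show ?thesis using H m by (simp add: algebra_simps)
    qed
    ultimately show "y = k * x - b \<and> x = - y\<^sup>2 / 2 + m_const k b"
      using assms by simp
  qed
  then show ?thesis by (auto simp: Gamma_line_def parabola_def)
qed

lemma parabola_Int_switching_curve:
  assumes "m_const k b > 0"
  shows "parabola (m_const k b) \<inter> switching_curve = {point_B k b}"
proof -
  have "y = - sqrt (m_const k b)" if "y\<^sup>2 = m_const k b" "y \<le> 0" for y
    using that real_sqrt_abs[of y] by simp
  then show ?thesis using assms
    by (auto simp: parabola_def switching_curve_def point_B_def)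
qed

definition W1 :: "real \<Rightarrow> real \<Rightarrow> (real \<times> real) set" where
  "W1 k b = {(x, y). y \<ge> k * x - b \<and> (y \<ge> - 1 / k \<longrightarrow> x \<le> - y\<^sup>2 / 2 + m_const k b)}"

definition W2 :: "real \<Rightarrow> real \<Rightarrow> (real \<times> real) set" where
  "W2 k b = {(x, y). y \<ge> - 1 / k \<and> x \<ge> m_const k b - y\<^sup>2 / 2 \<and>
                     (y \<ge> 0 \<longrightarrow> x \<le> b / k - y\<^sup>2 / 2) \<and>
                     (- 1 / k \<le> y \<and> y \<le> 0 \<longrightarrow> x \<le> (y + b) / k)}"

definition first_leg ::
  "real \<Rightarrow> real \<Rightarrow> real \<Rightarrow> (real \<Rightarrow> real) \<Rightarrow> (real \<Rightarrow> real) \<Rightarrow> (real \<Rightarrow> real) \<Rightarrow> bool"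
  where
  "first_leg k b t1 x y u \<longleftrightarrow>
     0 < t1 \<and> (AE t in lebesgue_on {0..t1}. u t = - 1) \<and>
     (x t1, y t1) \<in> open_segment (point_C k b) (point_E k b)"

text \<open>The type \<open>N'NCO\<close>: the legs \<open>N'N\<close>, \<open>NC\<close>, \<open>CO\<close> occupy \<open>[0,t1]\<close>, \<open>[t1,t2]\<close>, \<open>[t2,T]\<close>.
  That the motion starts at \<open>N'\<close> and ends at \<open>O\<close> is part of its admissibility.\<close>

definition type_N'NCO ::
  "real \<Rightarrow> real \<Rightarrow> real \<Rightarrow> (real \<Rightarrow> real) \<Rightarrow> (real \<Rightarrow> real) \<Rightarrow> (real \<Rightarrow> real) \<Rightarrow> bool"
  where
  "type_N'NCO k b T x y u \<longleftrightarrow>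
     (\<exists>t1 t2. t1 < t2 \<and> t2 < T \<and>
        first_leg k b t1 x y u \<and>
        (\<forall>t\<in>{t1..t2}. (x t, y t) \<in> Gamma_line k b) \<and>
        (AE t in lebesgue_on {t1..t2}. u t = k * y t) \<and>
        (x t2, y t2) = point_C k b \<and>
        (AE t in lebesgue_on {t2..T}. u t = 1))"

definition is_tail ::
  "real \<Rightarrow> real \<Rightarrow> (real \<Rightarrow> real) \<Rightarrow> (real \<Rightarrow> real) \<Rightarrow> (real \<Rightarrow> real) \<Rightarrow>
   real \<Rightarrow> (real \<Rightarrow> real) \<Rightarrow> (real \<Rightarrow> real) \<Rightarrow> (real \<Rightarrow> real) \<Rightarrow> bool"
  where
  "is_tail s T' x' y' u' T x y u \<longleftrightarrow>
     0 \<le> s \<and> s \<le> T' \<and> T = T' - s \<and>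
     (\<forall>t\<in>{0..T}. x t = x' (s + t) \<and> y t = y' (s + t) \<and> u t = u' (s + t))"

end

theory Submission
  imports Defs
begin

text \<open>
  Coincidence of \<open>A\<close>, \<open>B\<close>, \<open>C\<close> means \<open>2bk = 3\<close>. All optimality statements come from one comparison argument
  (\<open>motion_comparison\<close>), which needs no adjoint variables. Take a trajectory \<open>(xh, yh)\<close> that first moves with
  \<open>u = -1\<close>, then along \<open>\<Gamma>\<close>, then with \<open>u = +1\<close> to the origin, and any other admissible trajectory \<open>(x, y)\<close> from
  the same point in the same time. On the first leg \<open>u \<ge> -1\<close> gives \<open>y \<ge> yh\<close> and hence \<open>x \<ge> xh\<close>; on the
  second leg the state constraint gives \<open>x' \<ge> kx - b\<close>, against equality for \<open>xh\<close>, so \<open>x \<ge> xh\<close> persists by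
  Gronwall's argument; on the last leg, integrating backward from the origin, \<open>u \<le> 1\<close> gives \<open>x \<le> xh\<close>.
  So the two trajectories coincide. A trajectory that arrives sooner can be continued by resting at the origin,
  which leads to a contradiction; thus the three-leg trajectory is optimal and unique
  (\<open>three_leg_optimal\<close>).

  With an empty boundary leg the constraint is not used, and the argument yields the synthesis of
  the free problem (\<open>bang_bang_free_optimal\<close>; controls \<open>+1\<close>, \<open>-1\<close> follow by reflection in the origin). For a
  start in \<open>W1\<close> the bang-bang trajectory satisfies the constraint (\<open>W1_bang_bang\<close>), so both
  problems have the same optimal trajectories. For a start in the interior of \<open>W2\<close>, the parabola with \<open>u = -1\<close>
  hits \<open>\<Gamma>\<close> between \<open>C\<close> and \<open>E\<close> (\<open>interior_W2_reaches_Gamma\<close>) and the three-leg trajectory through the hitting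
  point exists (\<open>constrained_synthesis\<close>). For a start on the segment itself the first leg is empty; prolonging
  backward with \<open>u = -1\<close> leads into the interior of \<open>W2\<close>, and optimality of tails is Bellman's principle
  (\<open>optimal_tail\<close>).

  Trajectories are only Lipschitz with derivatives almost everywhere. The comparisons rest on the fact that a
  Lipschitz function whose derivative is nonnegative almost everywhere is nondecreasing
  (\<open>lipschitz_AE_deriv_nonneg_imp_le\<close>).
\<close>

section \<open>Lipschitz functions and almost everywhere derivatives\<close>

lemma AE_lebesgue_on_iff_negligible:
  fixes S :: "'a::euclidean_space set"
  assumes "S \<in> sets lebesgue"
  shows "(AE t in lebesgue_on S. P t) \<longleftrightarrow> negligible {t \<in> S. \<not> P t}"
proof -
  have "(AE t in lebesgue_on S. P t) \<longleftrightarrow> (AE t in lebesgue. t \<in> S \<longrightarrow> P t)"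
    using assms by (simp add: AE_restrict_space_iff)
  also have "\<dots> \<longleftrightarrow> {t. \<not> (t \<in> S \<longrightarrow> P t)} \<in> null_sets lebesgue"
    by (simp add: completion.AE_iff_null_sets)
  also have "{t. \<not> (t \<in> S \<longrightarrow> P t)} = {t \<in> S. \<not> P t}" by auto
  finally show ?thesis by (simp add: negligible_iff_null_sets)
qed

lemma interval_minus_negligible_nonempty:
  fixes c d :: real
  assumes "negligible N" "c < d"
  shows "\<exists>t\<in>{c<..<d}. t \<notin> N"
proof (rule ccontr)
  assume "\<not> ?thesis"
  then have "negligible {c<..<d}" using assms(1) by (blast intro: negligible_subset)
  then show False using assms(2) negligible_interval(2)[of c d] by (simp add: box_real)
qed

lemma continuous_AE_zero_imp_zero:
  fixes f :: "real \<Rightarrow> real"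
  assumes f: "continuous_on {a..b} f" and N: "negligible N" and "a < b"
    and zero: "\<And>t. t \<in> {a<..<b} - N \<Longrightarrow> f t = 0" and t: "t \<in> {a..b}"
  shows "f t = 0"
proof -
  have "{a..b} \<subseteq> closure ({a<..<b} - N)"
  proof (clarify, unfold closure_approachable, intro allI impI)
    fix s e :: real assume "s \<in> {a..b}" "e > 0"
    then have "max a (s - e) < min b (s + e)" using \<open>a < b\<close> by auto
    from interval_minus_negligible_nonempty[OF N this]
    obtain r where "r \<in> {max a (s - e)<..<min b (s + e)}" "r \<notin> N" by blast
    then show "\<exists>r\<in>{a<..<b} - N. dist r s < e"
      by (intro bexI[of _ r]) (auto simp: dist_real_def abs_less_iff)
  qed
  moreover have "closure ({a<..<b} - N) \<subseteq> {a..b}" by (rule closure_minimal) auto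
  ultimately have "closure ({a<..<b} - N) = {a..b}" by blast
  then show ?thesis using continuous_constant_on_closure[of "{a<..<b} - N" f 0 t] f zero t by auto
qed

text \<open>This replaces every use of absolute continuity. After adding a small linear term the derivative
  is bounded below by \<open>e > 0\<close> off \<open>N\<close>. If \<open>g a > g b\<close>, then, the Lipschitz image of \<open>N\<close> being negligible,
  some level \<open>c\<close> between \<open>g b\<close> and \<open>g a\<close> is not taken on \<open>N\<close>; at the last point where \<open>g \<ge> c\<close> the
  derivative exists and is positive, so that \<open>g\<close> exceeds \<open>c\<close> a little later, which is absurd.\<close>

lemma lipschitz_AE_deriv_nonneg_imp_le:
  fixes f :: "real \<Rightarrow> real"
  assumes lip: "L-lipschitz_on {a..b} f" and N: "negligible N"
    and deriv: "\<And>t. t \<in> {a<..<b} - N \<Longrightarrow> \<exists>D\<ge>0. (f has_real_derivative D) (at t within {a..b})"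
    and "a \<le> b"
  shows "f a \<le> f b"
proof (rule ccontr)
  assume "\<not> f a \<le> f b"
  then have fab: "f a > f b" by simp
  with \<open>a \<le> b\<close> have ab: "a < b" by (cases "a = b") auto
  define e where "e = (f a - f b) / (2 * (b - a))"
  have e: "e > 0" using fab ab by (simp add: e_def)
  define g where "g = (\<lambda>t. f t + e * t)"
  have eba: "e * (b - a) = (f a - f b) / 2"
    using ab by (simp only: e_def) (simp add: divide_simps; simp add: algebra_simps)
  have gab: "g b < g a"
  proof -
    have "g b - g a = e * (b - a) - (f a - f b)" by (simp add: g_def right_diff_distrib)
    also have "\<dots> = - ((f a - f b) / 2)" by (simp only: eba) (simp add: field_simps)
    also have "\<dots> < 0" using fab by simp
    finally show ?thesis by simp
  qed
  have lg: "(L + e)-lipschitz_on {a..b} g"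
    unfolding g_def using e
    by (intro lipschitz_on_add lip lipschitz_on_cmult_real_nonneg[where C=1, simplified])
      (auto intro: lipschitz_intros)
  have cg: "continuous_on {a..b} g" by (rule lipschitz_on_continuous_on[OF lg])
  have "negligible (g ` ({a..b} \<inter> N))"
  proof (rule negligible_locally_Lipschitz_image)
    show "negligible ({a..b} \<inter> N)" using N by (simp add: negligible_Int)
    fix x assume "x \<in> {a..b} \<inter> N"
    then show "\<exists>T B. open T \<and> x \<in> T \<and> (\<forall>y\<in>({a..b} \<inter> N) \<inter> T. norm (g y - g x) \<le> B * norm (y - x))"
      using lipschitz_on_normD[OF lg] by (intro exI[of _ UNIV] exI[of _ "L + e"]) auto
  qed simp
  from interval_minus_negligible_nonempty[OF this gab]
  obtain c where c: "g b < c" "c < g a" "c \<notin> g ` ({a..b} \<inter> N)" by force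
  define A where "A = {t \<in> {a..b}. g t \<ge> c}"
  have "compact A"
  proof -
    have "A = {a..b} \<inter> g -` {c..}" by (auto simp: A_def)
    moreover have "closed ({a..b} \<inter> g -` {c..})"
      by (intro continuous_closed_preimage cg) auto
    moreover have "bounded ({a..b} \<inter> g -` {c..})" by (rule bounded_subset[of "{a..b}"]) auto
    ultimately show ?thesis by (simp add: compact_eq_bounded_closed)
  qed
  moreover have "a \<in> A" using c ab by (simp add: A_def)
  ultimately obtain s where s: "s \<in> A" "\<And>t. t \<in> A \<Longrightarrow> t \<le> s"
    using compact_attains_sup[of A] by auto
  have sab: "a \<le> s" "s < b" using s(1) c by (auto simp: A_def less_le)
  have gs: "g s = c"
  proof (rule ccontr)
    assume "g s \<noteq> c"
    then have "c < g s" using s(1) by (auto simp: A_def)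
    have "\<exists>x\<ge>s. x \<le> b \<and> g x = c"
      by (rule IVT2') (use \<open>c < g s\<close> c sab in \<open>auto intro: continuous_on_subset[OF cg]\<close>)
    then obtain x where "x \<ge> s" "x \<le> b" "g x = c" by auto
    moreover have "x \<in> A" using calculation sab by (auto simp: A_def)
    ultimately have "x = s" using s(2) by force
    then show False using \<open>g x = c\<close> \<open>g s \<noteq> c\<close> by simp
  qed
  have "s \<noteq> a" using gs c by auto
  then have "s \<in> {a<..<b} - N" using sab gs c(3) by auto
  from deriv[OF this] obtain D where D: "D \<ge> 0" "(f has_real_derivative D) (at s within {a..b})" by auto
  have "(g has_real_derivative D + e) (at s within {a..b})"
    unfolding g_def using D(2) by (auto intro!: derivative_eq_intros)
  then have "(g has_real_derivative D + e) (at s)"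
    using sab \<open>s \<noteq> a\<close> by (simp add: at_within_Icc_at)
  from DERIV_pos_inc_right[OF this] obtain d where d: "d > 0" "\<And>h. 0 < h \<Longrightarrow> h < d \<Longrightarrow> g s < g (s + h)"
    using D e by auto
  define h where "h = min (d / 2) (b - s)"
  have "0 < h" "h < d" "s + h \<le> b" using d(1) sab by (auto simp: h_def)
  then have "s + h \<in> A" using d(2)[of h] gs sab by (auto simp: A_def)
  then show False using s(2) \<open>0 < h\<close> by force
qed

section \<open>Motions of the double integrator\<close>

text \<open>A motion on \<open>[a,b]\<close> is what remains of admissibility without the boundary conditions and the
  state constraint. The time interval is arbitrary, so that motions can be cut, shifted and joined;
  the three conditions that hold almost everywhere are collected in one negligible set.\<close>

definition motion ::
  "real \<Rightarrow> real \<Rightarrow> (real \<Rightarrow> real) \<Rightarrow> (real \<Rightarrow> real) \<Rightarrow> (real \<Rightarrow> real) \<Rightarrow> bool"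
  where
  "motion a b x y u \<longleftrightarrow>
     (\<exists>L. L-lipschitz_on {a..b} x) \<and>
     (\<exists>L. L-lipschitz_on {a..b} y) \<and>
     u \<in> borel_measurable (lebesgue_on {a..b}) \<and>
     negligible {t \<in> {a..b}. \<not> ((x has_real_derivative y t) (at t within {a..b}) \<and>
        (y has_real_derivative u t) (at t within {a..b}) \<and> \<bar>u t\<bar> \<le> 1)}"

lemma admissible_iff_motion:
  "admissible K p T x y u \<longleftrightarrow>
     0 \<le> T \<and> motion 0 T x y u \<and> (x 0, y 0) = p \<and> (x T, y T) = (0, 0) \<and>
     (\<forall>t\<in>{0..T}. (x t, y t) \<in> K)"
  unfolding admissible_def motion_def
  by (subst AE_lebesgue_on_iff_negligible[symmetric]) (auto simp: eventually_conj_iff)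

lemma motion_negligibleE:
  assumes "motion a b x y u"
  obtains N where "negligible N"
    "\<And>t. t \<in> {a..b} - N \<Longrightarrow> (x has_real_derivative y t) (at t within {a..b})"
    "\<And>t. t \<in> {a..b} - N \<Longrightarrow> (y has_real_derivative u t) (at t within {a..b})"
    "\<And>t. t \<in> {a..b} - N \<Longrightarrow> \<bar>u t\<bar> \<le> 1"
proof -
  let ?N = "{t \<in> {a..b}. \<not> ((x has_real_derivative y t) (at t within {a..b}) \<and>
        (y has_real_derivative u t) (at t within {a..b}) \<and> \<bar>u t\<bar> \<le> 1)}"
  show thesis
    by (rule that[of ?N]) (use assms in \<open>auto simp: motion_def\<close>)
qed

lemma motionI:
  assumes "L-lipschitz_on {a..b} x" "M-lipschitz_on {a..b} y"
    "u \<in> borel_measurable (lebesgue_on {a..b})" "negligible N"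
    "\<And>t. t \<in> {a..b} - N \<Longrightarrow> (x has_real_derivative y t) (at t within {a..b})"
    "\<And>t. t \<in> {a..b} - N \<Longrightarrow> (y has_real_derivative u t) (at t within {a..b})"
    "\<And>t. t \<in> {a..b} - N \<Longrightarrow> \<bar>u t\<bar> \<le> 1"
  shows "motion a b x y u"
  unfolding motion_def using assms
  by (auto intro: negligible_subset[OF \<open>negligible N\<close>])

text \<open>The controls need not agree at the endpoints: when two motions are joined, the value of the
  control at the junction is that of only one of them.\<close>

lemma motion_cong:
  assumes "motion a b x y u"
    and "\<And>t. t \<in> {a..b} \<Longrightarrow> x' t = x t \<and> y' t = y t"
    and "\<And>t. t \<in> {a<..<b} \<Longrightarrow> u' t = u t"
  shows "motion a b x' y' u'"
proof -
  from motion_negligibleE[OF assms(1)] obtain N where N: "negligible N"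
    "\<And>t. t \<in> {a..b} - N \<Longrightarrow> (x has_real_derivative y t) (at t within {a..b})"
    "\<And>t. t \<in> {a..b} - N \<Longrightarrow> (y has_real_derivative u t) (at t within {a..b})"
    "\<And>t. t \<in> {a..b} - N \<Longrightarrow> \<bar>u t\<bar> \<le> 1" by blast
  from assms(1) obtain L M where LM: "L-lipschitz_on {a..b} x" "M-lipschitz_on {a..b} y"
    "u \<in> borel_measurable (lebesgue_on {a..b})"
    by (auto simp: motion_def)
  show ?thesis
  proof (rule motionI)
    show "L-lipschitz_on {a..b} x'" using LM(1) by (rule lipschitz_on_transform) (use assms(2) in simp)
    show "M-lipschitz_on {a..b} y'" using LM(2) by (rule lipschitz_on_transform) (use assms(2) in simp)
    show "u' \<in> borel_measurable (lebesgue_on {a..b})"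
    proof (rule measurable_discrete_difference[OF LM(3), of "{a, b} \<inter> {a..b}"])
      show "{z} \<in> sets (lebesgue_on {a..b})" if "z \<in> {a, b} \<inter> {a..b}" for z
        using that by (auto simp: sets_restrict_space image_iff intro!: bexI[of _ "{z}"])
    qed (use assms(3) in auto)
    show "negligible (N \<union> {a, b})" using N(1) by auto
    fix t assume t': "t \<in> {a..b} - (N \<union> {a, b})"
    then have t: "t \<in> {a..b} - N" and u: "u' t = u t" using assms(3) by auto
    show "(x' has_real_derivative y' t) (at t within {a..b})"
      using has_field_derivative_transform_within[OF N(2)[OF t], of 1 x'] t assms(2) by auto
    show "(y' has_real_derivative u' t) (at t within {a..b})"
      using has_field_derivative_transform_within[OF N(3)[OF t], of 1 y'] t assms(2) u by auto
    show "\<bar>u' t\<bar> \<le> 1" using N(4)[OF t] u by auto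
  qed
qed

lemma motion_subinterval:
  assumes "motion a b x y u" "{c..d} \<subseteq> {a..b}"
  shows "motion c d x y u"
proof -
  from motion_negligibleE[OF assms(1)] obtain N where N: "negligible N"
    "\<And>t. t \<in> {a..b} - N \<Longrightarrow> (x has_real_derivative y t) (at t within {a..b})"
    "\<And>t. t \<in> {a..b} - N \<Longrightarrow> (y has_real_derivative u t) (at t within {a..b})"
    "\<And>t. t \<in> {a..b} - N \<Longrightarrow> \<bar>u t\<bar> \<le> 1" by blast
  from assms(1) obtain L M where LM: "L-lipschitz_on {a..b} x" "M-lipschitz_on {a..b} y"
    "u \<in> borel_measurable (lebesgue_on {a..b})"
    by (auto simp: motion_def)
  show ?thesis
  proof (rule motionI[OF _ _ _ N(1)])
    show "u \<in> borel_measurable (lebesgue_on {c..d})"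
      using LM(3) assms(2) measurable_restrict_mono by blast
    show "L-lipschitz_on {c..d} x" "M-lipschitz_on {c..d} y"
      using LM(1,2) assms(2) by (auto intro: lipschitz_on_subset simp del: atLeastatMost_subset_iff)
    fix t assume "t \<in> {c..d} - N"
    then have t: "t \<in> {a..b} - N" using assms(2) by blast
    show "(x has_real_derivative y t) (at t within {c..d})" by (rule DERIV_subset[OF N(2)[OF t] assms(2)])
    show "(y has_real_derivative u t) (at t within {c..d})" by (rule DERIV_subset[OF N(3)[OF t] assms(2)])
    show "\<bar>u t\<bar> \<le> 1" by (rule N(4)[OF t])
  qed
qed

lemma motion_join:
  assumes "motion a c x y u" "motion c b x y u" "a \<le> c" "c \<le> b"
  shows "motion a b x y u"
proof -
  from motion_negligibleE[OF assms(1)] obtain N where N: "negligible N"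
    "\<And>t. t \<in> {a..c} - N \<Longrightarrow> (x has_real_derivative y t) (at t within {a..c})"
    "\<And>t. t \<in> {a..c} - N \<Longrightarrow> (y has_real_derivative u t) (at t within {a..c})"
    "\<And>t. t \<in> {a..c} - N \<Longrightarrow> \<bar>u t\<bar> \<le> 1" by blast
  from motion_negligibleE[OF assms(2)] obtain N' where N': "negligible N'"
    "\<And>t. t \<in> {c..b} - N' \<Longrightarrow> (x has_real_derivative y t) (at t within {c..b})"
    "\<And>t. t \<in> {c..b} - N' \<Longrightarrow> (y has_real_derivative u t) (at t within {c..b})"
    "\<And>t. t \<in> {c..b} - N' \<Longrightarrow> \<bar>u t\<bar> \<le> 1" by blast
  from assms(1) obtain L M where LM: "L-lipschitz_on {a..c} x" "M-lipschitz_on {a..c} y"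
    and u: "u \<in> borel_measurable (lebesgue_on {a..c})"
    by (auto simp: motion_def)
  from assms(2) obtain L' M' where LM': "L'-lipschitz_on {c..b} x" "M'-lipschitz_on {c..b} y"
    and u': "u \<in> borel_measurable (lebesgue_on {c..b})"
    by (auto simp: motion_def)
  have E: "{a..b} = {a..c} \<union> {c..b}" using assms by auto
  have D: "(f has_real_derivative D) (at t within {a..b})"
    if "t \<in> {a..b} - {a, b, c}"
      "t < c \<Longrightarrow> (f has_real_derivative D) (at t within {a..c})"
      "t > c \<Longrightarrow> (f has_real_derivative D) (at t within {c..b})" for f t D
    using that by (cases "t < c") (auto simp: at_within_Icc_at)
  show ?thesis
  proof (rule motionI)
    show "(max L L')-lipschitz_on {a..b} x" using lipschitz_on_concat_max[OF LM(1) LM'(1)] by simp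
    show "(max M M')-lipschitz_on {a..b} y" using lipschitz_on_concat_max[OF LM(2) LM'(2)] by simp
    show "u \<in> borel_measurable (lebesgue_on {a..b})"
    proof -
      have "(\<lambda>t. if t \<in> {a..c} then u t else 0) \<in> borel_measurable lebesgue"
        "(\<lambda>t. if t \<in> {c..b} then u t else 0) \<in> borel_measurable lebesgue"
        by (rule borel_measurable_if_I; use u u' in simp)+
      then have "(\<lambda>t. if t \<in> {a..c} then (if t \<in> {a..c} then u t else 0)
                      else (if t \<in> {c..b} then u t else 0)) \<in> borel_measurable lebesgue"
        by (rule measurable_If_set) auto
      then have "(\<lambda>t. if t \<in> {a..b} then u t else 0) \<in> borel_measurable lebesgue"
        by (rule back_subst[where P = "\<lambda>f. f \<in> borel_measurable lebesgue"]) (use assms in auto)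
      then show ?thesis by (rule borel_measurable_if_D)
    qed
    show "negligible (N \<union> N' \<union> {a, b, c})" using N(1) N'(1) by auto
    fix t assume t: "t \<in> {a..b} - (N \<union> N' \<union> {a, b, c})"
    show "(x has_real_derivative y t) (at t within {a..b})"
      using t N(2)[of t] N'(2)[of t] by (intro D) auto
    show "(y has_real_derivative u t) (at t within {a..b})"
      using t N(3)[of t] N'(3)[of t] by (intro D) auto
    show "\<bar>u t\<bar> \<le> 1" using t N(4)[of t] N'(4)[of t] by (cases "t < c") auto
  qed
qed

lemma motion_shift:
  assumes "motion a b x y u"
  shows "motion (a - s) (b - s) (\<lambda>t. x (s + t)) (\<lambda>t. y (s + t)) (\<lambda>t. u (s + t))"
proof -
  from motion_negligibleE[OF assms(1)] obtain N where N: "negligible N"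
    "\<And>t. t \<in> {a..b} - N \<Longrightarrow> (x has_real_derivative y t) (at t within {a..b})"
    "\<And>t. t \<in> {a..b} - N \<Longrightarrow> (y has_real_derivative u t) (at t within {a..b})"
    "\<And>t. t \<in> {a..b} - N \<Longrightarrow> \<bar>u t\<bar> \<le> 1" by blast
  from assms(1) obtain L M where LM: "L-lipschitz_on {a..b} x" "M-lipschitz_on {a..b} y"
    and u: "u \<in> borel_measurable (lebesgue_on {a..b})"
    by (auto simp: motion_def)
  have im: "(\<lambda>t. s + t) ` {a - s..b - s} = {a..b}"
    by (auto simp: image_iff intro!: bexI[of _ "_ - s"])
  have D: "((\<lambda>t. f (s + t)) has_real_derivative D) (at t within {a - s..b - s})"
    if "(f has_real_derivative D) (at (s + t) within {a..b})" for f D t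
  proof -
    have "((\<lambda>t. s + t) has_real_derivative 1) (at t within {a - s..b - s})"
      by (auto intro!: derivative_eq_intros)
    from DERIV_image_chain[OF _ this, of f D] that show ?thesis by (simp add: im o_def)
  qed
  have lip: "C-lipschitz_on {a - s..b - s} (\<lambda>t. f (s + t))" if "C-lipschitz_on {a..b} f" for f :: "real \<Rightarrow> real" and C
  proof (rule lipschitz_onI)
    fix p q assume "p \<in> {a - s..b - s}" "q \<in> {a - s..b - s}"
    then show "dist (f (s + p)) (f (s + q)) \<le> C * dist p q"
      using lipschitz_onD[OF that, of "s + p" "s + q"] by (simp add: dist_real_def algebra_simps)
  qed (rule lipschitz_on_nonneg[OF that])
  show ?thesis
  proof (rule motionI)
    show "L-lipschitz_on {a - s..b - s} (\<lambda>t. x (s + t))" by (rule lip[OF LM(1)])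
    show "M-lipschitz_on {a - s..b - s} (\<lambda>t. y (s + t))" by (rule lip[OF LM(2)])
    show "negligible ((+) (- s) ` N)" by (rule negligible_translation[OF N(1)])
    show "(\<lambda>t. u (s + t)) \<in> borel_measurable (lebesgue_on {a - s..b - s})"
    proof (rule borel_measurable_if_D)
      have "(\<lambda>t. s + t) \<in> lebesgue \<rightarrow>\<^sub>M lebesgue"
        using lebesgue_affine_measurable[of "\<lambda>_. 1" s] by simp
      moreover have "(\<lambda>t. if t \<in> {a..b} then u t else 0) \<in> borel_measurable lebesgue"
        using u by (intro borel_measurable_if_I) auto
      ultimately have "(\<lambda>t. if s + t \<in> {a..b} then u (s + t) else 0) \<in> borel_measurable lebesgue"
        by (rule measurable_compose)
      then show "(\<lambda>t. if t \<in> {a - s..b - s} then u (s + t) else 0) \<in> borel_measurable lebesgue"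
        by (rule back_subst[where P = "\<lambda>f. f \<in> borel_measurable lebesgue"]) (auto simp: algebra_simps)
    qed
    fix t assume t: "t \<in> {a - s..b - s} - (+) (- s) ` N"
    then have t': "s + t \<in> {a..b} - N" by (auto simp: image_iff)
    show "((\<lambda>t. x (s + t)) has_real_derivative y (s + t)) (at t within {a - s..b - s})"
      by (rule D[OF N(2)[OF t']])
    show "((\<lambda>t. y (s + t)) has_real_derivative u (s + t)) (at t within {a - s..b - s})"
      by (rule D[OF N(3)[OF t']])
    show "\<bar>u (s + t)\<bar> \<le> 1" by (rule N(4)[OF t'])
  qed
qed

lemma motion_uminus:
  assumes "motion a b x y u"
  shows "motion a b (\<lambda>t. - x t) (\<lambda>t. - y t) (\<lambda>t. - u t)"
proof -
  from motion_negligibleE[OF assms(1)] obtain N where N: "negligible N"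
    "\<And>t. t \<in> {a..b} - N \<Longrightarrow> (x has_real_derivative y t) (at t within {a..b})"
    "\<And>t. t \<in> {a..b} - N \<Longrightarrow> (y has_real_derivative u t) (at t within {a..b})"
    "\<And>t. t \<in> {a..b} - N \<Longrightarrow> \<bar>u t\<bar> \<le> 1" by blast
  from assms(1) obtain L M where "L-lipschitz_on {a..b} x" "M-lipschitz_on {a..b} y"
    "u \<in> borel_measurable (lebesgue_on {a..b})"
    by (auto simp: motion_def)
  with N show ?thesis
    by (intro motionI[OF _ _ _ N(1), of L _ _ _ M]) (auto intro: DERIV_minus)
qed

lemma motion_classical:
  assumes x: "\<And>t. t \<in> {a..b} \<Longrightarrow> (x has_real_derivative y t) (at t)"
    and y: "\<And>t. t \<in> {a..b} \<Longrightarrow> (y has_real_derivative u t) (at t)"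
    and u: "continuous_on {a..b} u" "\<And>t. t \<in> {a..b} \<Longrightarrow> \<bar>u t\<bar> \<le> 1"
  shows "motion a b x y u"
proof -
  have lip: "C-lipschitz_on {a..b} f"
    if "\<And>t. t \<in> {a..b} \<Longrightarrow> (f has_real_derivative g t) (at t)"
      "\<And>t. t \<in> {a..b} \<Longrightarrow> \<bar>g t\<bar> \<le> C" "0 \<le> C" for f g C
  proof (rule lipschitz_onI)
    fix s t assume "s \<in> {a..b}" "t \<in> {a..b}"
    then show "dist (f s) (f t) \<le> C * dist s t"
      using field_differentiable_bound[of "{a..b}" f g C s t] that
      by (auto simp: dist_real_def abs_minus_commute intro: has_field_derivative_at_within)
  qed (rule that)
  have "continuous_on {a..b} y"
    by (rule DERIV_continuous_on[where D = u]) (use y has_field_derivative_at_within in blast)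
  then have "bounded (y ` {a..b})"
    by (intro compact_imp_bounded compact_continuous_image) auto
  then obtain C where "C > 0" "\<And>t. t \<in> {a..b} \<Longrightarrow> \<bar>y t\<bar> \<le> C"
    by (auto simp: bounded_pos)
  then show ?thesis
    using lip[of x y C] lip[of y u 1] assms
    by (intro motionI[of C _ _ _ 1 _ _ "{}"] continuous_imp_measurable_on_sets_lebesgue)
      (auto intro: has_field_derivative_at_within)
qed

section \<open>Comparison of motions and optimality\<close>

lemma lipschitz_on_mult_real:
  fixes f g :: "real \<Rightarrow> real"
  assumes f: "L-lipschitz_on {a..b} f" and g: "M-lipschitz_on {a..b} g"
  shows "\<exists>C. C-lipschitz_on {a..b} (\<lambda>t. f t * g t)"
proof -
  have "bounded (f ` {a..b})" "bounded (g ` {a..b})"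
    by (intro compact_imp_bounded compact_continuous_image compact_Icc
        lipschitz_on_continuous_on[OF f] lipschitz_on_continuous_on[OF g])+
  then obtain F G where F: "F > 0" "\<And>t. t \<in> {a..b} \<Longrightarrow> \<bar>f t\<bar> \<le> F"
    and G: "G > 0" "\<And>t. t \<in> {a..b} \<Longrightarrow> \<bar>g t\<bar> \<le> G"
    by (auto simp: bounded_pos)
  have "(L * G + F * M)-lipschitz_on {a..b} (\<lambda>t. f t * g t)"
  proof (rule lipschitz_onI)
    fix s t assume st: "s \<in> {a..b}" "t \<in> {a..b}"
    have "\<bar>f s * g s - f t * g t\<bar> = \<bar>(f s - f t) * g s + f t * (g s - g t)\<bar>"
      by (simp add: algebra_simps)
    also have "\<dots> \<le> \<bar>f s - f t\<bar> * \<bar>g s\<bar> + \<bar>f t\<bar> * \<bar>g s - g t\<bar>"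
      by (rule order_trans[OF abs_triangle_ineq]) (simp add: abs_mult)
    also have "\<dots> \<le> (L * \<bar>s - t\<bar>) * G + F * (M * \<bar>s - t\<bar>)"
      using lipschitz_onD[OF f st] lipschitz_onD[OF g st] F(2)[OF st(2)] G(2)[OF st(1)] F(1)
        lipschitz_on_nonneg[OF f]
      by (intro add_mono mult_mono) (auto simp: dist_real_def)
    finally show "dist (f s * g s) (f t * g t) \<le> (L * G + F * M) * dist s t"
      by (simp add: dist_real_def algebra_simps)
  next
    show "0 \<le> L * G + F * M"
      using F(1) G(1) lipschitz_on_nonneg[OF f] lipschitz_on_nonneg[OF g] by simp
  qed
  then show ?thesis by blast
qed

text \<open>The trajectory determines its control almost everywhere.\<close>

lemma motion_controls_eq:
  assumes m: "motion a b x y u" and m': "motion a b x' y' u'"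
    and eq: "\<And>t. t \<in> {a..b} \<Longrightarrow> y t = y' t"
  shows "negligible {t \<in> {a..b}. u t \<noteq> u' t}"
proof -
  from motion_negligibleE[OF m] obtain N where N: "negligible N"
    "\<And>t. t \<in> {a..b} - N \<Longrightarrow> (y has_real_derivative u t) (at t within {a..b})" by metis
  from motion_negligibleE[OF m'] obtain N' where N': "negligible N'"
    "\<And>t. t \<in> {a..b} - N' \<Longrightarrow> (y' has_real_derivative u' t) (at t within {a..b})" by metis
  have "u t = u' t" if t: "t \<in> {a<..<b} - N - N'" for t
  proof -
    have "(y has_real_derivative u t) (at t within {a..b})" using N(2)[of t] t by auto
    moreover have "(y has_real_derivative u' t) (at t within {a..b})"
      by (rule has_field_derivative_transform_within[OF N'(2), of t 1]) (use t eq in auto)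
    ultimately show ?thesis using t by (auto simp: at_within_Icc_at intro: DERIV_unique)
  qed
  then have "{t \<in> {a..b}. u t \<noteq> u' t} \<subseteq> N \<union> N' \<union> {a, b}" by force
  then show ?thesis by (rule negligible_subset[rotated]) (use N(1) N'(1) in auto)
qed

text \<open>The heart of the argument. The reference motion \<open>(xh, yh)\<close> consists of a leg with control \<open>-1\<close>, a
  leg on the line \<open>y = kx - b\<close> and a leg with control \<open>+1\<close>; the other motion has the same endpoints, takes
  the same time and obeys the state constraint during the second leg. With \<open>X = x - xh\<close> and
  \<open>Y = y - yh\<close>, the bound on the control makes \<open>Y \<ge> 0\<close> on the first leg (integrating forward from \<open>Y = 0\<close>)
  and on the last leg (integrating backward from \<open>Y = 0\<close>), so \<open>X\<close> is nondecreasing there; on the second leg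
  \<open>Y - kX \<ge> 0\<close> makes \<open>exp (-kt) X\<close> nondecreasing. Since \<open>X\<close> vanishes at both ends it vanishes throughout.
  If \<open>t1 = t2\<close>, the state constraint is not used.\<close>

lemma motion_comparison:
  assumes m: "motion 0 T x y u" and mh: "motion 0 T xh yh uh"
    and le: "0 \<le> t1" "t1 \<le> t2" "t2 \<le> T"
    and start: "x 0 = xh 0" "y 0 = yh 0" and final: "x T = xh T" "y T = yh T"
    and leg1: "\<And>t. t \<in> {0<..<t1} \<Longrightarrow> uh t = - 1"
    and leg2: "\<And>t. t \<in> {t1<..<t2} \<Longrightarrow> yh t = k * xh t - b" "\<And>t. t \<in> {t1<..<t2} \<Longrightarrow> k * x t - b \<le> y t"
    and leg3: "\<And>t. t \<in> {t2<..<T} \<Longrightarrow> uh t = 1"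
    and t: "t \<in> {0..T}"
  shows "x t = xh t" "y t = yh t"
proof -
  from motion_negligibleE[OF m] obtain N1 where N1: "negligible N1"
    "\<And>t. t \<in> {0..T} - N1 \<Longrightarrow> (x has_real_derivative y t) (at t within {0..T})"
    "\<And>t. t \<in> {0..T} - N1 \<Longrightarrow> (y has_real_derivative u t) (at t within {0..T})"
    "\<And>t. t \<in> {0..T} - N1 \<Longrightarrow> \<bar>u t\<bar> \<le> 1" by blast
  from motion_negligibleE[OF mh] obtain N2 where N2: "negligible N2"
    "\<And>t. t \<in> {0..T} - N2 \<Longrightarrow> (xh has_real_derivative yh t) (at t within {0..T})"
    "\<And>t. t \<in> {0..T} - N2 \<Longrightarrow> (yh has_real_derivative uh t) (at t within {0..T})" by metis
  from m mh obtain L1 M1 L2 M2 where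
    L: "L1-lipschitz_on {0..T} x" "M1-lipschitz_on {0..T} y"
    "L2-lipschitz_on {0..T} xh" "M2-lipschitz_on {0..T} yh"
    by (auto simp: motion_def)
  define N where "N = N1 \<union> N2"
  have N: "negligible N" using N1(1) N2(1) by (simp add: N_def)
  define X where "X = (\<lambda>t. x t - xh t)"
  define Y where "Y = (\<lambda>t. y t - yh t)"
  define F where "F = (\<lambda>t. exp (- k * t) * X t)"
  have lX: "(L1 + L2)-lipschitz_on {0..T} X" and lY: "(M1 + M2)-lipschitz_on {0..T} Y"
    unfolding X_def Y_def using L by (auto intro: lipschitz_on_diff)
  obtain C where lF: "C-lipschitz_on {0..T} F"
  proof -
    have "\<exists>C. C-lipschitz_on {0..T} (\<lambda>t. exp (- k * t))"
    proof -
      have "(\<bar>k\<bar> * exp (\<bar>k\<bar> * T))-lipschitz_on {0..T} (\<lambda>t. exp (- k * t))"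
      proof (rule lipschitz_onI)
        fix s t assume st: "s \<in> {0..T}" "t \<in> {0..T}"
        have "norm (exp (- k * s) - exp (- k * t)) \<le> (\<bar>k\<bar> * exp (\<bar>k\<bar> * T)) * norm (s - t)"
        proof (rule field_differentiable_bound[of "{0..T}" _ "\<lambda>r. exp (- k * r) * - k"])
          fix r assume r: "r \<in> {0..T}"
          show "((\<lambda>t. exp (- k * t)) has_real_derivative exp (- k * r) * - k) (at r within {0..T})"
            by (auto intro!: derivative_eq_intros)
          have "- k * r \<le> \<bar>k\<bar> * r" using r by (intro mult_right_mono) auto
          also have "\<dots> \<le> \<bar>k\<bar> * T" using r by (intro mult_left_mono) auto
          finally show "norm (exp (- k * r) * - k) \<le> \<bar>k\<bar> * exp (\<bar>k\<bar> * T)"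
            by (simp add: abs_mult mult.commute mult_left_mono)
        qed (use st in auto)
        then show "dist (exp (- k * s)) (exp (- k * t)) \<le> (\<bar>k\<bar> * exp (\<bar>k\<bar> * T)) * dist s t"
          by (simp add: dist_real_def)
      qed simp
      then show ?thesis by blast
    qed
    then show thesis using lipschitz_on_mult_real[OF _ lX] that by (auto simp: F_def)
  qed
  have dX: "(X has_real_derivative Y r) (at r within {0..T})" if "r \<in> {0..T} - N" for r
    unfolding X_def Y_def by (rule DERIV_diff) (use that N1 N2 in \<open>auto simp: N_def\<close>)
  have dY: "(Y has_real_derivative u r - uh r) (at r within {0..T})" if "r \<in> {0..T} - N" for r
    unfolding Y_def by (rule DERIV_diff) (use that N1 N2 in \<open>auto simp: N_def\<close>)
  have dF: "(F has_real_derivative exp (- k * r) * (Y r - k * X r)) (at r within {0..T})"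
    if "r \<in> {0..T} - N" for r
    unfolding F_def by (rule derivative_eq_intros dX[OF that] refl)+ (simp add: algebra_simps)
  have mono: "f c \<le> f d"
    if "0 \<le> c" "c \<le> d" "d \<le> T" "C-lipschitz_on {0..T} f"
      "\<And>r. r \<in> {c<..<d} - N \<Longrightarrow> (f has_real_derivative g r) (at r within {0..T}) \<and> 0 \<le> g r"
    for f g C c d
  proof (rule lipschitz_AE_deriv_nonneg_imp_le[OF _ N _ \<open>c \<le> d\<close>])
    have sub: "{c..d} \<subseteq> {0..T}" using that by auto
    show "C-lipschitz_on {c..d} f" by (rule lipschitz_on_subset[OF that(4) sub])
    show "\<exists>D\<ge>0. (f has_real_derivative D) (at r within {c..d})" if "r \<in> {c<..<d} - N" for r
      using \<open>\<And>r. r \<in> {c<..<d} - N \<Longrightarrow> _\<close>[OF that] DERIV_subset[OF _ sub] by blast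
  qed
  have X0: "X 0 = 0" "Y 0 = 0" "X T = 0" "Y T = 0" using start final by (auto simp: X_def Y_def)
  have Y1: "0 \<le> Y r" if "r \<in> {0..t1}" for r
  proof -
    have "Y 0 \<le> Y r"
    proof (rule mono[OF _ _ _ lY])
      fix s assume s: "s \<in> {0<..<r} - N"
      then have "s \<in> {0..T} - N" using that le by auto
      then show "(Y has_real_derivative u s - uh s) (at s within {0..T}) \<and> 0 \<le> u s - uh s"
        using dY[of s] N1(4)[of s] leg1[of s] s that by (auto simp: N_def abs_le_iff)
    qed (use that le in auto)
    then show ?thesis using X0 by simp
  qed
  have Y3: "0 \<le> Y r" if "r \<in> {t2..T}" for r
  proof -
    have "- Y r \<le> - Y T"
    proof (rule mono[where f = "\<lambda>t. - Y t" and C = "M1 + M2" and g = "\<lambda>s. - (u s - uh s)"])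
      fix s assume s: "s \<in> {r<..<T} - N"
      then have "s \<in> {0..T} - N" using that le by auto
      then show "((\<lambda>t. - Y t) has_real_derivative - (u s - uh s)) (at s within {0..T}) \<and> 0 \<le> - (u s - uh s)"
        using DERIV_minus[OF dY[of s]] N1(4)[of s] leg3[of s] s that by (auto simp: N_def abs_le_iff)
    qed (use that le lY in auto)
    then show ?thesis using X0 by simp
  qed
  have X1: "X c \<le> X d" if "0 \<le> c" "c \<le> d" "d \<le> t1 \<or> t2 \<le> c" "d \<le> T" for c d
  proof (rule mono[OF _ _ _ lX])
    fix s assume s: "s \<in> {c<..<d} - N"
    then show "(X has_real_derivative Y s) (at s within {0..T}) \<and> 0 \<le> Y s"
      using dX[of s] Y1[of s] Y3[of s] that by auto
  qed (use that le in auto)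
  have F2: "F c \<le> F d" if "t1 \<le> c" "c \<le> d" "d \<le> t2" for c d
  proof (rule mono[OF _ _ _ lF])
    fix s assume s: "s \<in> {c<..<d} - N"
    then have "0 \<le> Y s - k * X s"
      using leg2[of s] that by (simp add: X_def Y_def algebra_simps)
    then show "(F has_real_derivative exp (- k * s) * (Y s - k * X s)) (at s within {0..T}) \<and>
        0 \<le> exp (- k * s) * (Y s - k * X s)"
      using dF[of s] s that le by auto
  qed (use that le in auto)
  have X0': "X r = 0" if "r \<in> {0..T}" for r
  proof -
    have F0: "F s \<le> 0 \<longleftrightarrow> X s \<le> 0" "0 \<le> F s \<longleftrightarrow> 0 \<le> X s" for s
      by (simp_all add: F_def mult_le_0_iff zero_le_mult_iff)
    have a: "0 \<le> X t1" using X1[of 0 t1] X0 le by simp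
    have b: "X t2 \<le> 0" using X1[of t2 T] X0 le by simp
    have c: "F s = 0" if "t1 \<le> s" "s \<le> t2" for s
      using F2[of t1 s] F2[of s t2] F0[of t1] F0[of t2] a b that by linarith
    then have c': "X s = 0" if "t1 \<le> s" "s \<le> t2" for s
      using that by (force simp: F_def)
    show ?thesis
      using X1[of 0 r] X1[of r t1] X1[of t2 r] X1[of r T] c'[of t1] c'[of t2] c'[of r] X0 le that
      by force
  qed
  have Y0': "Y t = 0"
  proof (cases "T = 0")
    case False
    then have "0 < T" using t by auto
    show ?thesis
    proof (rule continuous_AE_zero_imp_zero[OF lipschitz_on_continuous_on[OF lY] N \<open>0 < T\<close> _ t])
      fix r assume r: "r \<in> {0<..<T} - N"
      have "(X has_real_derivative 0) (at r within {0..T})"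
        by (rule has_field_derivative_transform_within[OF DERIV_const[of 0], of 1]) (use r X0' in auto)
      then show "Y r = 0" using dX[of r] r by (auto simp: at_within_Icc_at intro: DERIV_unique)
    qed
  qed (use X0 t in auto)
  show "x t = xh t" "y t = yh t" using X0'[OF t] Y0' by (auto simp: X_def Y_def)
qed

lemma motion_extend_zero:
  assumes m: "motion 0 S x y u" and "x S = 0" "y S = 0" and le: "0 \<le> S" "S \<le> T"
  shows "motion 0 T (\<lambda>t. if t \<le> S then x t else 0) (\<lambda>t. if t \<le> S then y t else 0)
     (\<lambda>t. if t \<le> S then u t else 0)" (is "motion 0 T ?x ?y ?u")
proof (rule motion_join[OF _ _ le])
  show "motion 0 S ?x ?y ?u" by (rule motion_cong[OF m]) auto
  have "motion S T (\<lambda>_. 0) (\<lambda>_. 0) (\<lambda>_. 0)" by (rule motion_classical) auto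
  then show "motion S T ?x ?y ?u" by (rule motion_cong) (use assms in auto)
qed

text \<open>A motion that arrives earlier is continued by resting at the origin and then compared with the
  reference motion. It cannot be shorter, because resting requires the control \<open>0\<close> where the
  reference control is \<open>1\<close>; hence the condition that the last leg has positive length unless \<open>T = 0\<close>.\<close>

lemma three_leg_minimal:
  assumes adm: "admissible K p T xh yh uh"
    and le: "0 \<le> t1" "t1 \<le> t2" "t2 \<le> T" and pos: "0 < T \<Longrightarrow> t2 < T"
    and leg1: "\<And>t. t \<in> {0<..<t1} \<Longrightarrow> uh t = - 1"
    and leg2: "\<And>t. t \<in> {t1<..<t2} \<Longrightarrow> yh t = k * xh t - b"
    and K: "t1 < t2 \<Longrightarrow> K \<subseteq> constraint_set k b"
    and leg3: "\<And>t. t \<in> {t2<..<T} \<Longrightarrow> uh t = 1"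
    and adm': "admissible K p S x y u" and "S \<le> T"
  shows "S = T" "t \<in> {0..T} \<Longrightarrow> x t = xh t \<and> y t = yh t"
proof -
  have mh: "motion 0 T xh yh uh" and eh: "(xh 0, yh 0) = p" "xh T = 0" "yh T = 0" "(0, 0) \<in> K"
    using adm by (auto simp: admissible_iff_motion dest: bspec[of _ _ T])
  have m: "motion 0 S x y u" and e: "(x 0, y 0) = p" "x S = 0" "y S = 0" "0 \<le> S"
    and xyK: "\<And>t. t \<in> {0..S} \<Longrightarrow> (x t, y t) \<in> K"
    using adm' by (auto simp: admissible_iff_motion)
  let ?x = "\<lambda>t. if t \<le> S then x t else 0" and ?y = "\<lambda>t. if t \<le> S then y t else 0"
  let ?u = "\<lambda>t. if t \<le> S then u t else 0"
  have mE: "motion 0 T ?x ?y ?u" by (rule motion_extend_zero[OF m]) (use e \<open>S \<le> T\<close> in auto)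
  have inK: "(?x t, ?y t) \<in> K" if "0 \<le> t" for t using xyK[of t] eh that by auto
  have eq: "?x t = xh t" "?y t = yh t" if "t \<in> {0..T}" for t
  proof -
    have K2: "k * ?x r - b \<le> ?y r" if "r \<in> {t1<..<t2}" for r
    proof -
      have "(?x r, ?y r) \<in> constraint_set k b" using inK[of r] K that le by force
      then show ?thesis by (simp add: constraint_set_def)
    qed
    show "?x t = xh t" "?y t = yh t"
      using motion_comparison[OF mE mh le _ _ _ _ leg1 leg2 K2 leg3 that] e eh \<open>S \<le> T\<close> by auto
  qed
  show "S = T"
  proof (rule ccontr)
    assume "S \<noteq> T"
    then have "S < T" using \<open>S \<le> T\<close> by simp
    then have "max S t2 < T" using pos e by auto
    \<comment> \<open>On this final time interval the extended motion rests while the reference control is \<open>1\<close>.\<close>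
    have "negligible {t \<in> {0..T}. ?u t \<noteq> uh t}"
      by (rule motion_controls_eq[OF mE mh]) (use eq in auto)
    from interval_minus_negligible_nonempty[OF this \<open>max S t2 < T\<close>]
    obtain t where t: "t \<in> {max S t2<..<T}" "t \<notin> {t \<in> {0..T}. ?u t \<noteq> uh t}" by blast
    then have "?u t = uh t" using e by auto
    then show False using t(1) leg3[of t] by auto
  qed
  then show "x t = xh t \<and> y t = yh t" if "t \<in> {0..T}" using eq[OF that] that by auto
qed

lemma three_leg_optimal:
  assumes adm: "admissible K p T xh yh uh"
    and le: "0 \<le> t1" "t1 \<le> t2" "t2 \<le> T" and pos: "0 < T \<Longrightarrow> t2 < T"
    and leg1: "\<And>t. t \<in> {0<..<t1} \<Longrightarrow> uh t = - 1"
    and leg2: "\<And>t. t \<in> {t1<..<t2} \<Longrightarrow> yh t = k * xh t - b"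
    and K: "t1 < t2 \<Longrightarrow> K \<subseteq> constraint_set k b"
    and leg3: "\<And>t. t \<in> {t2<..<T} \<Longrightarrow> uh t = 1"
  shows "optimal K p T xh yh uh"
    and "optimal K p S x y u \<Longrightarrow> S = T \<and> (\<forall>t\<in>{0..T}. x t = xh t \<and> y t = yh t)"
proof -
  note min = three_leg_minimal[OF adm le pos leg1 leg2 K leg3]
  show "optimal K p T xh yh uh"
    unfolding optimal_def
  proof (intro conjI allI impI adm)
    fix T' x' y' u' assume "admissible K p T' x' y' u'"
    then show "T \<le> T'" using min(1)[of T' x' y' u'] by linarith
  qed
  assume o: "optimal K p S x y u"
  then have "S \<le> T" "admissible K p S x y u" using adm by (auto simp: optimal_def)
  then show "S = T \<and> (\<forall>t\<in>{0..T}. x t = xh t \<and> y t = yh t)" using min by blast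
qed

section \<open>Concatenations, tails and bang-bang motions\<close>

lemma admissible_prepend:
  assumes m: "motion 0 s x1 y1 u1" and "0 \<le> s" and q: "(x1 0, y1 0) = q"
    and K: "\<And>t. t \<in> {0..s} \<Longrightarrow> (x1 t, y1 t) \<in> K"
    and adm: "admissible K (x1 s, y1 s) T x y u"
  shows "admissible K q (s + T) (\<lambda>t. if t < s then x1 t else x (t - s))
     (\<lambda>t. if t < s then y1 t else y (t - s)) (\<lambda>t. if t < s then u1 t else u (t - s))"
    (is "admissible K q (s + T) ?x ?y ?u")
proof -
  have a: "0 \<le> T" "motion 0 T x y u" "x 0 = x1 s" "y 0 = y1 s" "x T = 0" "y T = 0"
    "\<And>t. t \<in> {0..T} \<Longrightarrow> (x t, y t) \<in> K"
    using adm by (auto simp: admissible_iff_motion)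
  have "motion 0 (s + T) ?x ?y ?u"
  proof (rule motion_join)
    show "motion 0 s ?x ?y ?u" by (rule motion_cong[OF m]) (use a in auto)
    have "motion s (s + T) (\<lambda>t. x (- s + t)) (\<lambda>t. y (- s + t)) (\<lambda>t. u (- s + t))"
      using motion_shift[OF a(2), of "- s"] by (simp add: add.commute)
    then show "motion s (s + T) ?x ?y ?u" by (rule motion_cong) auto
  qed (use a \<open>0 \<le> s\<close> in auto)
  moreover have "(?x t, ?y t) \<in> K" if "t \<in> {0..s + T}" for t
    using K[of t] a(7)[of "t - s"] that by auto
  ultimately show ?thesis
    using a q \<open>0 \<le> s\<close> unfolding admissible_iff_motion by auto
qed

text \<open>Bellman's principle.\<close>

lemma optimal_tail:
  assumes opt: "optimal K q T' x' y' u'" and tail: "is_tail s T' x' y' u' T x y u"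
  shows "optimal K (x 0, y 0) T x y u"
proof -
  have s: "0 \<le> s" "s \<le> T'" "T = T' - s"
    and eq: "\<And>t. t \<in> {0..T} \<Longrightarrow> x t = x' (s + t) \<and> y t = y' (s + t) \<and> u t = u' (s + t)"
    using tail by (auto simp: is_tail_def)
  have a: "motion 0 T' x' y' u'" "(x' 0, y' 0) = q" "x' T' = 0" "y' T' = 0"
    "\<And>t. t \<in> {0..T'} \<Longrightarrow> (x' t, y' t) \<in> K"
    using opt by (auto simp: admissible_iff_motion optimal_def)
  have s0: "x 0 = x' s" "y 0 = y' s" using eq[of 0] s by auto
  have "motion s T' x' y' u'" by (rule motion_subinterval[OF a(1)]) (use s in auto)
  from motion_shift[OF this, of s]
  have "motion 0 T (\<lambda>t. x' (s + t)) (\<lambda>t. y' (s + t)) (\<lambda>t. u' (s + t))" by (simp add: s)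
  then have "motion 0 T x y u" by (rule motion_cong) (use eq in auto)
  moreover have "x T = 0" "y T = 0" using eq[of T] s a by auto
  moreover have "(x t, y t) \<in> K" if "t \<in> {0..T}" for t
    using eq[OF that] a(5)[of "s + t"] that s by auto
  ultimately have adm: "admissible K (x 0, y 0) T x y u"
    using s by (auto simp: admissible_iff_motion)
  moreover have "T \<le> S" if "admissible K (x 0, y 0) S f g h" for S f g h
  proof -
    have "motion 0 s x' y' u'" by (rule motion_subinterval[OF a(1)]) (use s in auto)
    from admissible_prepend[OF this s(1) a(2), of K S f g h] that a(5) s s0
    have "\<exists>f g h. admissible K q (s + S) f g h" by auto
    then have "T' \<le> s + S" using opt by (auto simp: optimal_def)
    then show ?thesis using s by simp
  qed
  ultimately show ?thesis by (auto simp: optimal_def)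
qed

lemma admissible_uminus:
  assumes "admissible UNIV p T x y u"
  shows "admissible UNIV (- p) T (\<lambda>t. - x t) (\<lambda>t. - y t) (\<lambda>t. - u t)"
proof -
  have "motion 0 T (\<lambda>t. - x t) (\<lambda>t. - y t) (\<lambda>t. - u t)"
    using assms by (intro motion_uminus) (simp add: admissible_iff_motion)
  then show ?thesis using assms by (auto simp: admissible_iff_motion)
qed

lemma free_optimal_uminus:
  assumes "free_optimal p T x y u"
  shows "free_optimal (- p) T (\<lambda>t. - x t) (\<lambda>t. - y t) (\<lambda>t. - u t)"
  unfolding optimal_def
proof (intro conjI allI impI)
  show "admissible UNIV (- p) T (\<lambda>t. - x t) (\<lambda>t. - y t) (\<lambda>t. - u t)"
    using assms by (intro admissible_uminus) (simp add: optimal_def)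
  fix T' x' y' u' assume "admissible UNIV (- p) T' x' y' u'"
  from admissible_uminus[OF this] show "T \<le> T'" using assms by (auto simp: optimal_def)
qed

text \<open>Bang-bang motions with one switching are three-leg motions with an empty boundary leg, after
  a reflection in the origin if the first control is \<open>+1\<close>.\<close>

lemma bang_bang_free_optimal:
  assumes s: "s = 1 \<or> s = - 1" and adm: "admissible UNIV p T xh yh uh"
    and le: "0 \<le> \<tau>" "\<tau> \<le> T" "0 < T \<Longrightarrow> \<tau> < T"
    and leg1: "\<And>t. t \<in> {0<..<\<tau>} \<Longrightarrow> uh t = - s"
    and leg2: "\<And>t. t \<in> {\<tau><..<T} \<Longrightarrow> uh t = s"
  shows "free_optimal p T xh yh uh"
    and "free_optimal p S x y u \<Longrightarrow> S = T \<and> (\<forall>t\<in>{0..T}. x t = xh t \<and> y t = yh t)"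
proof -
  have plus: "free_optimal q T f g h \<and>
    (free_optimal q S x y u \<longrightarrow> S = T \<and> (\<forall>t\<in>{0..T}. x t = f t \<and> y t = g t))"
    if adm: "admissible UNIV q T f g h"
      and legs: "\<And>t. t \<in> {0<..<\<tau>} \<Longrightarrow> h t = - 1" "\<And>t. t \<in> {\<tau><..<T} \<Longrightarrow> h t = 1"
    for q f g h x y u
  proof -
    \<comment> \<open>The boundary leg is empty, so that the slope and the offset of the line are irrelevant.\<close>
    note syn = three_leg_optimal[where k = 0 and b = 0, OF adm le(1) order_refl le(2,3) legs(1) _ _ legs(2)]
    have "free_optimal q T f g h" by (rule syn(1)) simp_all
    moreover have "S = T \<and> (\<forall>t\<in>{0..T}. x t = f t \<and> y t = g t)" if "free_optimal q S x y u"
      by (rule syn(2)[OF _ _ _ _ _ that]) simp_all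
    ultimately show ?thesis by blast
  qed
  have "free_optimal p T xh yh uh \<and>
    (free_optimal p S x y u \<longrightarrow> S = T \<and> (\<forall>t\<in>{0..T}. x t = xh t \<and> y t = yh t))"
    using s
  proof
    assume "s = 1"
    then show ?thesis using leg1 leg2 by (intro plus[OF adm]) auto
  next
    assume "s = - 1"
    then have *: "free_optimal (- p) T (\<lambda>t. - xh t) (\<lambda>t. - yh t) (\<lambda>t. - uh t) \<and>
      (free_optimal (- p) S (\<lambda>t. - x t) (\<lambda>t. - y t) (\<lambda>t. - u t) \<longrightarrow>
       S = T \<and> (\<forall>t\<in>{0..T}. - x t = - xh t \<and> - y t = - yh t))"
      using leg1 leg2 by (intro plus[OF admissible_uminus[OF adm]]) auto
    have "free_optimal p T xh yh uh"
      using free_optimal_uminus[OF conjunct1[OF *]] by simp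
    moreover have "S = T \<and> (\<forall>t\<in>{0..T}. x t = xh t \<and> y t = yh t)" if "free_optimal p S x y u"
      using conjunct2[OF *] free_optimal_uminus[OF that] by simp
    ultimately show ?thesis by blast
  qed
  then show "free_optimal p T xh yh uh"
    and "free_optimal p S x y u \<Longrightarrow> S = T \<and> (\<forall>t\<in>{0..T}. x t = xh t \<and> y t = yh t)" by auto
qed

text \<open>If the free problem has an optimal trajectory that is unique in the state and satisfies the
  constraint, then imposing the constraint changes nothing.\<close>

lemma optimal_iff_free_optimal:
  assumes adm: "admissible K p T xh yh uh" and opt: "free_optimal p T xh yh uh"
    and unique: "\<And>S x y u. free_optimal p S x y u \<Longrightarrow> S = T \<and> (\<forall>t\<in>{0..T}. x t = xh t \<and> y t = yh t)"
  shows "optimal K p S x y u \<longleftrightarrow> free_optimal p S x y u" "optimal K p T xh yh uh"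
proof -
  have K_UNIV: "admissible UNIV p S x y u" if "admissible K p S x y u" for S x y u
    using that by (simp add: admissible_iff_motion)
  show *: "optimal K p T xh yh uh"
    using adm opt K_UNIV unfolding optimal_def by blast
  show "optimal K p S x y u \<longleftrightarrow> free_optimal p S x y u"
  proof
    assume o: "optimal K p S x y u"
    then have "S \<le> T" using adm by (auto simp: optimal_def)
    then show "free_optimal p S x y u"
      using o opt K_UNIV unfolding optimal_def by (meson order_trans)
  next
    assume f: "free_optimal p S x y u"
    from unique[OF f] have "S = T" and eq: "\<And>t. t \<in> {0..T} \<Longrightarrow> x t = xh t \<and> y t = yh t" by auto
    have "admissible K p S x y u"
      using f adm eq \<open>S = T\<close> by (auto simp: optimal_def admissible_iff_motion)
    then show "optimal K p S x y u" using * \<open>S = T\<close> by (auto simp: optimal_def)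
  qed
qed

lemma motion_parabola:
  assumes "\<bar>s\<bar> \<le> 1"
  shows "motion a b (\<lambda>t. x0 + y0 * t + s * t\<^sup>2 / 2) (\<lambda>t. y0 + s * t) (\<lambda>_. s)"
proof (rule motion_classical)
  fix t
  show "((\<lambda>t. x0 + y0 * t + s * t\<^sup>2 / 2) has_real_derivative y0 + s * t) (at t)"
    by (auto intro!: derivative_eq_intros)
  show "((\<lambda>t. y0 + s * t) has_real_derivative s) (at t)"
    by (auto intro!: derivative_eq_intros)
qed (use assms in simp_all)

lemma admissible_final_leg:
  assumes s: "s = 1 \<or> s = - 1" and "0 \<le> r"
    and K: "\<And>q. q \<in> {0..r} \<Longrightarrow> (s * q\<^sup>2 / 2, - s * q) \<in> K"
  shows "admissible K (s * r\<^sup>2 / 2, - s * r) r (\<lambda>t. s * (r - t)\<^sup>2 / 2) (\<lambda>t. - s * (r - t)) (\<lambda>_. s)"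
proof -
  have "motion 0 r (\<lambda>t. s * (r - t)\<^sup>2 / 2) (\<lambda>t. - s * (r - t)) (\<lambda>_. s)"
  proof (rule motion_classical)
    show "\<bar>s\<bar> \<le> 1" using s by auto
  qed (auto intro!: derivative_eq_intros simp: field_simps)
  moreover have "(s * (r - t)\<^sup>2 / 2, - s * (r - t)) \<in> K" if "t \<in> {0..r}" for t
    using K[of "r - t"] that by simp
  ultimately show ?thesis using \<open>0 \<le> r\<close> by (auto simp: admissible_iff_motion)
qed

lemma admissible_bang_bang:
  assumes s: "s = 1 \<or> s = - 1" and "0 \<le> \<tau>" "0 \<le> r"
    and y\<tau>: "y0 - s * \<tau> = - s * r" and x\<tau>: "x0 + y0 * \<tau> - s * \<tau>\<^sup>2 / 2 = s * r\<^sup>2 / 2"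
    and K1: "\<And>t. t \<in> {0..\<tau>} \<Longrightarrow> (x0 + y0 * t - s * t\<^sup>2 / 2, y0 - s * t) \<in> K"
    and K2: "\<And>q. q \<in> {0..r} \<Longrightarrow> (s * q\<^sup>2 / 2, - s * q) \<in> K"
  shows "\<exists>x y u. admissible K (x0, y0) (\<tau> + r) x y u \<and>
    (\<forall>t\<in>{0<..<\<tau>}. u t = - s) \<and> (\<forall>t\<in>{\<tau><..<\<tau> + r}. u t = s)"
proof -
  let ?x = "\<lambda>t. x0 + y0 * t + - s * t\<^sup>2 / 2" and ?y = "\<lambda>t. y0 + - s * t"
  have m: "motion 0 \<tau> ?x ?y (\<lambda>_. - s)"
    by (rule motion_parabola) (use s in auto)
  have f: "admissible K (?x \<tau>, ?y \<tau>) r (\<lambda>t. s * (r - t)\<^sup>2 / 2) (\<lambda>t. - s * (r - t)) (\<lambda>_. s)"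
  proof -
    have "?x \<tau> = s * r\<^sup>2 / 2" "?y \<tau> = - s * r" using y\<tau> x\<tau> by simp_all
    then show ?thesis using admissible_final_leg[OF s \<open>0 \<le> r\<close> K2] by (simp only:)
  qed
  have "admissible K (x0, y0) (\<tau> + r) (\<lambda>t. if t < \<tau> then ?x t else s * (r - (t - \<tau>))\<^sup>2 / 2)
     (\<lambda>t. if t < \<tau> then ?y t else - s * (r - (t - \<tau>))) (\<lambda>t. if t < \<tau> then - s else s)"
    by (rule admissible_prepend[OF m \<open>0 \<le> \<tau>\<close> _ _ f]) (use K1 in auto)
  then show ?thesis
    by (intro exI conjI, assumption) auto
qed

section \<open>Starting points in \<open>W1\<close>\<close>

text \<open>From here on \<open>2bk = 3\<close>, which is what coincidence of the points \<open>A\<close>, \<open>B\<close>, \<open>C\<close> amounts to.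
  In the rescaled coordinates \<open>X = k\<^sup>2x\<close>, \<open>Y = ky\<close> the constraint reads \<open>X - 3/2 \<le> Y\<close>.\<close>

lemma mem_constraint_set_iff:
  assumes "k > 0" "b = 3 / (2 * k)"
  shows "(x, y) \<in> constraint_set k b \<longleftrightarrow> k\<^sup>2 * x - 3 / 2 \<le> k * y"
proof -
  have "k * x - b \<le> y \<longleftrightarrow> k * (k * x - b) \<le> k * y" using assms by simp
  also have "k * (k * x - b) = k\<^sup>2 * x - 3 / 2"
    using assms by (simp add: power2_eq_square field_simps)
  finally show ?thesis by (simp add: constraint_set_def)
qed

lemma lower_switching_arc_in_constraint_set:
  assumes "k > 0" "b = 3 / (2 * k)" "y \<le> 0" "- 1 \<le> k * y"
  shows "(y\<^sup>2 / 2, y) \<in> constraint_set k b"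
proof -
  have "(k * y - 3) * (k * y + 1) \<le> 0"
    using assms mult_nonneg_nonpos[of k y] by (intro mult_nonpos_nonneg) auto
  then show ?thesis
    unfolding mem_constraint_set_iff[OF assms(1,2)] by (simp add: power2_eq_square algebra_simps)
qed

text \<open>Points on the right of the switching curve, and those on its lower branch, get the controls
  \<open>-1\<close>, \<open>+1\<close>; points on the left, and those on its upper branch, get \<open>+1\<close>, \<open>-1\<close>. On the switching curve
  the first leg is then empty, and the second leg is nonempty except at the origin. In the first case
  the start lies on or inside the parabola tangent to \<open>\<Gamma>\<close>, and so does the first leg. In the second
  case the only critical part of the first leg is that with \<open>y < 0\<close>, where the gap between \<open>\<Gamma>\<close> and the trajectory grows.\<close>

lemma W1_bang_bang:
  assumes k: "k > 0" "b = 3 / (2 * k)" and p: "(x0, y0) \<in> W1 k b"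
  obtains s \<tau> T x y u where "s = 1 \<or> s = - 1" "admissible (constraint_set k b) (x0, y0) T x y u"
    "0 \<le> \<tau>" "\<tau> \<le> T" "0 < T \<Longrightarrow> \<tau> < T" "\<And>t. t \<in> {0<..<\<tau>} \<Longrightarrow> u t = - s"
    "\<And>t. t \<in> {\<tau><..<T} \<Longrightarrow> u t = s"
proof -
  note K_iff = mem_constraint_set_iff[OF k]
  have m: "m_const k b = 1 / k\<^sup>2" using k by (simp add: m_const_def)
  have start: "k\<^sup>2 * x0 - 3 / 2 \<le> k * y0"
    using p by (simp add: W1_def constraint_set_def flip: K_iff)
  have tangent: "x0 + y0\<^sup>2 / 2 \<le> 1 / k\<^sup>2" if "- 1 \<le> k * y0"
  proof -
    have "- 1 / k \<le> y0" using that k by (simp add: field_simps)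
    then show ?thesis using p by (simp add: W1_def m)
  qed
  show thesis
  proof (cases "y0 < 0 \<and> x0 \<ge> y0\<^sup>2 / 2 \<or> y0 \<ge> 0 \<and> x0 > - y0\<^sup>2 / 2")
    case True
    \<comment> \<open>The first leg lies on \<open>x = c - y\<^sup>2/2\<close> and meets the switching curve at \<open>y = -r\<close>.\<close>
    define c where "c = x0 + y0\<^sup>2 / 2"
    define r where "r = sqrt c"
    have low: "- 1 \<le> k * y0"
    proof (rule ccontr)
      \<comment> \<open>Below the ordinate \<open>-1/k\<close> the line \<open>\<Gamma>\<close> runs on the left of the switching curve.\<close>
      assume "\<not> ?thesis"
      then have *: "k * y0 < - 1" by simp
      have "y0 < 0"
      proof (rule ccontr)
        assume "\<not> y0 < 0"
        then have "0 \<le> k * y0" using k(1) by simp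
        then show False using * by simp
      qed
      then have "k\<^sup>2 * (y0\<^sup>2 / 2) \<le> k\<^sup>2 * x0" using True by (intro mult_left_mono) auto
      moreover have "(k * y0 - 3) * (k * y0 + 1) > 0" using * by (intro mult_neg_neg) auto
      ultimately show False using start by (simp add: power2_eq_square algebra_simps)
    qed
    have c: "0 < c" "y0 < 0 \<Longrightarrow> y0\<^sup>2 \<le> c" "c \<le> 1 / k\<^sup>2"
      using True tangent[OF low] zero_less_power2[of y0] unfolding c_def by linarith+
    have r: "0 < r" "r\<^sup>2 = c" using c by (auto simp: r_def)
    have y0r: "0 \<le> y0 + r"
      using c(2) r real_le_rsqrt[of "- y0" c] by (cases "y0 < 0") (auto simp: r_def)
    have kr: "k * r \<le> 1"
    proof -
      have "(k * r)\<^sup>2 \<le> 1\<^sup>2" using c(3) k r by (simp add: power_mult_distrib field_simps)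
      then show ?thesis by (rule power2_le_imp_le) simp
    qed
    have "\<exists>x y u. admissible (constraint_set k b) (x0, y0) ((y0 + r) + r) x y u \<and>
      (\<forall>t\<in>{0<..<y0 + r}. u t = - 1) \<and> (\<forall>t\<in>{y0 + r<..<(y0 + r) + r}. u t = 1)"
    proof (rule admissible_bang_bang)
      show "x0 + y0 * (y0 + r) - 1 * (y0 + r)\<^sup>2 / 2 = 1 * r\<^sup>2 / 2"
        using r(2) by (simp add: c_def power2_eq_square field_simps)
    next
      fix t assume "t \<in> {0..y0 + r}"
      define y where "y = y0 - t"
      have x: "x0 + y0 * t - 1 * t\<^sup>2 / 2 = c - y\<^sup>2 / 2"
        by (simp add: c_def y_def power2_eq_square field_simps)
      have "k\<^sup>2 * c \<le> 1" using c(3) k by (simp add: field_simps)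
      moreover have "0 \<le> (k * y + 1)\<^sup>2" by simp
      ultimately have "(c - y\<^sup>2 / 2, y) \<in> constraint_set k b"
        unfolding K_iff by (simp add: power2_eq_square algebra_simps)
      then show "(x0 + y0 * t - 1 * t\<^sup>2 / 2, y0 - 1 * t) \<in> constraint_set k b"
        unfolding x by (simp add: y_def)
    next
      fix q assume q: "q \<in> {0..r}"
      have "k * q \<le> k * r" using q k by simp
      with kr have "k * q \<le> 1" by simp
      then show "(1 * q\<^sup>2 / 2, - 1 * q) \<in> constraint_set k b"
        using lower_switching_arc_in_constraint_set[OF k, of "- q"] q by simp
    qed (use y0r r in auto)
    then obtain x y u where "admissible (constraint_set k b) (x0, y0) ((y0 + r) + r) x y u"
      "\<And>t. t \<in> {0<..<y0 + r} \<Longrightarrow> u t = - 1" "\<And>t. t \<in> {y0 + r<..<(y0 + r) + r} \<Longrightarrow> u t = 1"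
      by blast
    then show thesis using y0r r by (intro that[of 1 "(y0 + r) + r" x y u "y0 + r"]) auto
  next
    case False
    \<comment> \<open>The first leg lies on \<open>x = y\<^sup>2/2 - d\<close> and meets the switching curve at \<open>y = r\<close>.\<close>
    define d where "d = y0\<^sup>2 / 2 - x0"
    define r where "r = sqrt d"
    have d: "0 \<le> d" "y0 \<ge> 0 \<Longrightarrow> y0\<^sup>2 \<le> d" "y0 < 0 \<Longrightarrow> 0 < d"
      using False zero_le_power2[of y0] unfolding d_def by linarith+
    have r: "0 \<le> r" "r\<^sup>2 = d" using d by (auto simp: r_def)
    have y0r: "0 \<le> r - y0"
    proof (cases "y0 < 0")
      case False
      then show ?thesis using d(2) real_le_rsqrt[of y0 d] by (simp add: r_def)
    qed (use r in simp)
    have pos: "r = 0 \<Longrightarrow> r - y0 = 0"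
      using d r by (cases "y0 < 0") auto
    have "\<exists>x y u. admissible (constraint_set k b) (x0, y0) ((r - y0) + r) x y u \<and>
      (\<forall>t\<in>{0<..<r - y0}. u t = - (- 1)) \<and> (\<forall>t\<in>{r - y0<..<(r - y0) + r}. u t = - 1)"
    proof (rule admissible_bang_bang)
      show "x0 + y0 * (r - y0) - - 1 * (r - y0)\<^sup>2 / 2 = - 1 * r\<^sup>2 / 2"
        using r(2) by (simp add: d_def power2_eq_square field_simps)
    next
      fix t assume t: "t \<in> {0..r - y0}"
      define y where "y = y0 + t"
      have x: "x0 + y0 * t - - 1 * t\<^sup>2 / 2 = y\<^sup>2 / 2 - d"
        by (simp add: d_def y_def power2_eq_square field_simps)
      have y: "y0 \<le> y" "y \<le> r" using t by (auto simp: y_def)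
      have "(y\<^sup>2 / 2 - d, y) \<in> constraint_set k b"
      proof (cases "y \<ge> 0")
        case True
        then have "y\<^sup>2 \<le> d" using power_mono[OF y(2) True, of 2] r by simp
        then have "y\<^sup>2 / 2 - d \<le> 0" using d by linarith
        then have "k\<^sup>2 * (y\<^sup>2 / 2 - d) \<le> 0" by (intro mult_nonneg_nonpos) auto
        moreover have "0 \<le> k * y" using True k by simp
        ultimately show ?thesis unfolding K_iff by linarith
      next
        case False
        have "k * y \<le> 0" "k * y0 \<le> k * y" using False y k by (auto simp: mult_nonneg_nonpos)
        then have "0 \<le> (k * y - k * y0) * (2 - k * y - k * y0)" by (intro mult_nonneg_nonneg) auto
        moreover have "k\<^sup>2 * x0 = (k * y0)\<^sup>2 / 2 - k\<^sup>2 * d"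
          by (simp add: d_def power_mult_distrib algebra_simps)
        ultimately show ?thesis using start unfolding K_iff
          by (simp add: power2_eq_square algebra_simps)
      qed
      then show "(x0 + y0 * t - - 1 * t\<^sup>2 / 2, y0 - - 1 * t) \<in> constraint_set k b"
        unfolding x by (simp add: y_def)
    next
      fix q assume q: "q \<in> {0..r}"
      have "k\<^sup>2 * (- 1 * q\<^sup>2 / 2) \<le> 0" by simp
      moreover have "0 \<le> k * (- (- 1) * q)" using q k by simp
      ultimately show "(- 1 * q\<^sup>2 / 2, - (- 1) * q) \<in> constraint_set k b" unfolding K_iff by linarith
    qed (use y0r r in auto)
    then obtain x y u where "admissible (constraint_set k b) (x0, y0) ((r - y0) + r) x y u"
      "\<And>t. t \<in> {0<..<r - y0} \<Longrightarrow> u t = - (- 1)" "\<And>t. t \<in> {r - y0<..<(r - y0) + r} \<Longrightarrow> u t = - 1"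
      by blast
    then show thesis
      using y0r r pos by (intro that[of "- 1" "(r - y0) + r" x y u "r - y0"]) (auto simp: less_le)
  qed
qed

lemma W1_synthesis:
  assumes k: "k > 0" "b = 3 / (2 * k)" and p: "p \<in> W1 k b"
  shows "\<exists>T x y u. optimal (constraint_set k b) p T x y u"
    and "optimal (constraint_set k b) p T x y u \<longleftrightarrow> free_optimal p T x y u"
proof -
  obtain x0 y0 where "p = (x0, y0)" by (cases p)
  from W1_bang_bang[OF k p[unfolded this], folded this]
  obtain s \<tau> S xh yh uh where s: "s = 1 \<or> s = - 1" and adm: "admissible (constraint_set k b) p S xh yh uh"
    and *: "0 \<le> \<tau>" "\<tau> \<le> S" "0 < S \<Longrightarrow> \<tau> < S" "\<And>t. t \<in> {0<..<\<tau>} \<Longrightarrow> uh t = - s"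
    "\<And>t. t \<in> {\<tau><..<S} \<Longrightarrow> uh t = s" by metis
  have free: "admissible UNIV p S xh yh uh" using adm by (simp add: admissible_iff_motion)
  have opt: "free_optimal p S xh yh uh"
    by (rule bang_bang_free_optimal(1)[OF s free *])
  have unique: "R = S \<and> (\<forall>t\<in>{0..S}. f t = xh t \<and> g t = yh t)"
    if "free_optimal p R f g h" for R f g h
    using bang_bang_free_optimal(2)[OF s free * that] .
  show "optimal (constraint_set k b) p T x y u \<longleftrightarrow> free_optimal p T x y u"
    by (rule optimal_iff_free_optimal(1)[OF adm opt unique])
  have "optimal (constraint_set k b) p S xh yh uh"
    by (rule optimal_iff_free_optimal(2)[OF adm opt unique])
  then show "\<exists>T x y u. optimal (constraint_set k b) p T x y u" by blast
qed

section \<open>Trajectories with a boundary leg\<close>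

lemma boundary_rescaled:
  fixes k b y :: real
  assumes k: "k > 0" "b = 3 / (2 * k)"
  shows "k\<^sup>2 * ((y + b) / k) = k * y + 3 / 2"
  unfolding k(2) using k(1) by (simp add: power2_eq_square field_simps)

lemma mem_open_segment_CE_iff:
  assumes k: "k > 0" "b = 3 / (2 * k)"
  shows "(x, y) \<in> open_segment (point_C k b) (point_E k b) \<longleftrightarrow>
    x = (y + b) / k \<and> - 1 < k * y \<and> y < 0"
proof -
  have C: "point_C k b = ((- 1 / k + b) / k, - 1 / k)" and E: "point_E k b = ((0 + b) / k, 0)"
    unfolding point_C_def point_E_def using k(1)
    by (simp_all add: power2_eq_square diff_divide_distrib add_divide_distrib)
  have "point_C k b \<noteq> point_E k b" using k by (simp add: point_C_def point_E_def)
  then have "(x, y) \<in> open_segment (point_C k b) (point_E k b) \<longleftrightarrow>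
     (\<exists>v>0. v < 1 \<and> x = (1 - v) * ((- 1 / k + b) / k) + v * (b / k) \<and> y = (1 - v) * (- 1 / k))"
    by (auto simp: in_segment C E)
  also have "\<dots> \<longleftrightarrow> x = (y + b) / k \<and> - 1 < k * y \<and> y < 0"
  proof
    assume "\<exists>v>0. v < 1 \<and> x = (1 - v) * ((- 1 / k + b) / k) + v * (b / k) \<and> y = (1 - v) * (- 1 / k)"
    then obtain v where v: "0 < v" "v < 1" and x: "x = (1 - v) * ((- 1 / k + b) / k) + v * (b / k)"
      and y: "y = (1 - v) * (- 1 / k)" by blast
    have "k * y = v - 1" using k y by simp
    moreover have "x = (y + b) / k" unfolding x y using k by (simp add: field_simps)
    moreover have "y < 0" unfolding y using k v by (simp add: divide_simps)
    ultimately show "x = (y + b) / k \<and> - 1 < k * y \<and> y < 0" using v by simp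
  next
    assume *: "x = (y + b) / k \<and> - 1 < k * y \<and> y < 0"
    then have "k * y < 0" using k by (simp add: mult_pos_neg)
    then show "\<exists>v>0. v < 1 \<and> x = (1 - v) * ((- 1 / k + b) / k) + v * (b / k) \<and> y = (1 - v) * (- 1 / k)"
    proof (intro exI[of _ "1 + k * y"] conjI)
      show "x = (1 - (1 + k * y)) * ((- 1 / k + b) / k) + (1 + k * y) * (b / k)"
        using * k(1) by (simp add: field_simps)
    qed (use * \<open>k * y < 0\<close> k(1) in auto)
  qed
  finally show ?thesis .
qed

text \<open>On \<open>\<Gamma>\<close> the control \<open>u = ky\<close> gives \<open>y(t) = w exp(kt)\<close>. The boundary time is the time in which this
  motion leads from ordinate \<open>w\<close> down to the ordinate \<open>-1/k\<close> of \<open>C\<close>, where \<open>\<bar>ky\<bar>\<close> reaches the bound \<open>1\<close>.\<close>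

definition boundary_time :: "real \<Rightarrow> real \<Rightarrow> real" where
  "boundary_time k w = ln (- 1 / (k * w)) / k"

lemma boundary_time_reaches_C:
  assumes "k > 0" "- 1 < k * w" "w < 0"
  shows "0 < boundary_time k w" "k * (w * exp (k * boundary_time k w)) = - 1"
proof -
  have kw: "k * w < 0" using assms by (simp add: mult_pos_neg)
  then have *: "1 < - 1 / (k * w)" using assms(2) by (simp add: divide_simps)
  then show "0 < boundary_time k w"
    using assms(1) by (simp only: boundary_time_def divide_pos_pos ln_gt_zero)
  have "exp (k * boundary_time k w) = - 1 / (k * w)"
  proof -
    have "k * boundary_time k w = ln (- 1 / (k * w))" using assms(1) by (simp add: boundary_time_def)
    then show ?thesis using order_less_trans[OF zero_less_one *] by (simp only: exp_ln)
  qed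
  then show "k * (w * exp (k * boundary_time k w)) = - 1" using assms(1,3) by simp
qed

lemma admissible_boundary_arc:
  assumes k: "k > 0" "b = 3 / (2 * k)" and w: "- 1 < k * w" "w < 0"
  defines "\<tau> \<equiv> boundary_time k w"
  obtains x y u where "admissible (constraint_set k b) ((w + b) / k, w) (\<tau> + 1 / k) x y u"
    "\<And>t. t \<in> {0..\<tau>} \<Longrightarrow> (x t, y t) \<in> Gamma_line k b"
    "(x \<tau>, y \<tau>) = point_C k b" "\<And>t. t \<in> {0..<\<tau>} \<Longrightarrow> u t = k * y t"
    "\<And>t. t \<in> {\<tau>..\<tau> + 1 / k} \<Longrightarrow> u t = 1"
proof -
  note bt = boundary_time_reaches_C[OF k(1) w, folded \<tau>_def]
  let ?y = "\<lambda>t. w * exp (k * t)" and ?x = "\<lambda>t. (w * exp (k * t) + b) / k"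
  have C: "point_C k b = (1 * (1 / k)\<^sup>2 / 2, - 1 * (1 / k))"
    using k by (simp add: point_C_def power2_eq_square field_simps)
  have y\<tau>: "?y \<tau> = - 1 / k" using bt(2) k by (simp add: field_simps)
  have C': "(?x \<tau>, ?y \<tau>) = point_C k b"
    unfolding y\<tau> using k by (simp add: point_C_def power2_eq_square field_simps)
  have m: "motion 0 \<tau> ?x ?y (\<lambda>t. k * ?y t)"
  proof (rule motion_classical)
    fix t assume t: "t \<in> {0..\<tau>}"
    show "(?x has_real_derivative ?y t) (at t)"
      using k by (auto intro!: derivative_eq_intros)
    show "(?y has_real_derivative k * ?y t) (at t)"
      by (auto intro!: derivative_eq_intros)
    have "k * ?y \<tau> \<le> k * ?y t"
      using k w t by (intro mult_left_mono mult_left_mono_neg) auto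
    moreover have "k * ?y t \<le> 0" using k w by (simp add: mult_nonneg_nonpos mult_nonpos_nonneg)
    ultimately show "\<bar>k * ?y t\<bar> \<le> 1" using bt(2) by (simp add: abs_le_iff)
  qed (auto intro!: continuous_intros)
  have f: "admissible (constraint_set k b) (?x \<tau>, ?y \<tau>) (1 / k)
     (\<lambda>t. 1 * (1 / k - t)\<^sup>2 / 2) (\<lambda>t. - 1 * (1 / k - t)) (\<lambda>_. 1)"
    unfolding C' unfolding C
  proof (rule admissible_final_leg)
    fix q assume q: "q \<in> {0..1 / k}"
    then have "k * q \<le> k * (1 / k)" using k by (intro mult_left_mono) auto
    then show "(1 * q\<^sup>2 / 2, - 1 * q) \<in> constraint_set k b"
      using lower_switching_arc_in_constraint_set[OF k, of "- q"] q k by simp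
  qed (use k in auto)
  have K: "(?x t, ?y t) \<in> Gamma_line k b" for t using k by (simp add: Gamma_line_def)
  have K': "(?x t, ?y t) \<in> constraint_set k b" for t using k by (simp add: constraint_set_def)
  have adm: "admissible (constraint_set k b) ((w + b) / k, w) (\<tau> + 1 / k)
     (\<lambda>t. if t < \<tau> then ?x t else 1 * (1 / k - (t - \<tau>))\<^sup>2 / 2)
     (\<lambda>t. if t < \<tau> then ?y t else - 1 * (1 / k - (t - \<tau>)))
     (\<lambda>t. if t < \<tau> then k * ?y t else 1)" (is "admissible _ _ _ ?X ?Y ?U")
    by (rule admissible_prepend[OF m _ _ K' f]) (use bt in auto)
  show thesis
  proof (rule that[OF adm])
    show X\<tau>: "(?X \<tau>, ?Y \<tau>) = point_C k b" unfolding C by simp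
    show "(?X t, ?Y t) \<in> Gamma_line k b" if "t \<in> {0..\<tau>}" for t
    proof (cases "t < \<tau>")
      case True
      then show ?thesis using K[of t] by simp
    next
      case False
      then have "t = \<tau>" using that by simp
      then show ?thesis using X\<tau> C' K[of \<tau>] by simp
    qed
  qed auto
qed

text \<open>The motion with \<open>u = -1\<close> that arrives at the point of \<open>\<Gamma>\<close> with ordinate \<open>w\<close> after time \<open>d\<close>. Along it
  the distance to \<open>\<Gamma>\<close> is governed by \<open>(ky + 1)\<^sup>2 - (kw + 1)\<^sup>2\<close>, which is nonnegative because \<open>y \<ge> w > -1/k\<close>.\<close>

lemma admissible_prepend_parabola:
  assumes k: "k > 0" "b = 3 / (2 * k)" and w: "- 1 < k * w" and "0 \<le> d"
    and adm: "admissible (constraint_set k b) ((w + b) / k, w) T x y u"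
  shows "admissible (constraint_set k b) ((w + b) / k + (w\<^sup>2 - (w + d)\<^sup>2) / 2, w + d) (d + T)
    (\<lambda>t. if t < d then (w + b) / k + (w\<^sup>2 - (w + d - t)\<^sup>2) / 2 else x (t - d))
    (\<lambda>t. if t < d then w + d - t else y (t - d)) (\<lambda>t. if t < d then - 1 else u (t - d))"
proof -
  have m: "motion 0 d (\<lambda>t. (w + b) / k + (w\<^sup>2 - (w + d - t)\<^sup>2) / 2) (\<lambda>t. w + d - t) (\<lambda>t. - 1)"
    by (rule motion_classical) (auto intro!: derivative_eq_intros)
  have K: "((w + b) / k + (w\<^sup>2 - (w + d - t)\<^sup>2) / 2, w + d - t) \<in> constraint_set k b"
    if "t \<in> {0..d}" for t
  proof -
    define v where "v = w + d - t"
    have "k * w \<le> k * v" using that k by (simp add: v_def)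
    then have "(k * w + 1)\<^sup>2 \<le> (k * v + 1)\<^sup>2" using w by (intro power_mono) auto
    moreover have "k\<^sup>2 * ((w + b) / k + (w\<^sup>2 - v\<^sup>2) / 2) = ((k * w + 1)\<^sup>2 - (k * v)\<^sup>2) / 2 + 1"
      using k by (simp add: power2_eq_square field_simps)
    ultimately show ?thesis
      unfolding mem_constraint_set_iff[OF k] v_def[symmetric]
      by (simp add: power2_eq_square algebra_simps)
  qed
  have stop: "((w + b) / k + (w\<^sup>2 - (w + d - d)\<^sup>2) / 2, w + d - d) = ((w + b) / k, w)" by simp
  show ?thesis
    by (rule admissible_prepend[OF m \<open>0 \<le> d\<close> _ K adm[folded stop]]) simp_all
qed

text \<open>The case \<open>d = 0\<close> is included: it treats starting points on \<open>\<Gamma>\<close> itself, with an empty first leg.\<close>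

lemma constrained_synthesis:
  assumes k: "k > 0" "b = 3 / (2 * k)" and w: "- 1 < k * w" "w < 0" and d: "0 \<le> d"
  defines "\<tau> \<equiv> boundary_time k w"
    and "q \<equiv> ((w + b) / k + (w\<^sup>2 - (w + d)\<^sup>2) / 2, w + d)"
  obtains x y u where "optimal (constraint_set k b) q (d + (\<tau> + 1 / k)) x y u"
    "\<And>t. t \<in> {0..<d} \<Longrightarrow> u t = - 1" "(x d, y d) = ((w + b) / k, w)"
    "\<And>t. t \<in> {d..d + \<tau>} \<Longrightarrow> (x t, y t) \<in> Gamma_line k b"
    "\<And>t. t \<in> {d..<d + \<tau>} \<Longrightarrow> u t = k * y t"
    "(x (d + \<tau>), y (d + \<tau>)) = point_C k b"
    "\<And>t. t \<in> {d + \<tau>..d + (\<tau> + 1 / k)} \<Longrightarrow> u t = 1"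
    "\<And>S f g h. optimal (constraint_set k b) q S f g h \<Longrightarrow>
       S = d + (\<tau> + 1 / k) \<and> (\<forall>t\<in>{0..d + (\<tau> + 1 / k)}. f t = x t \<and> g t = y t)"
proof -
  have \<tau>: "0 < \<tau>" using boundary_time_reaches_C(1)[OF k(1) w] by (simp add: \<tau>_def)
  obtain x y u where arc: "admissible (constraint_set k b) ((w + b) / k, w) (\<tau> + 1 / k) x y u"
    "\<And>t. t \<in> {0..\<tau>} \<Longrightarrow> (x t, y t) \<in> Gamma_line k b"
    "(x \<tau>, y \<tau>) = point_C k b" "\<And>t. t \<in> {0..<\<tau>} \<Longrightarrow> u t = k * y t"
    "\<And>t. t \<in> {\<tau>..\<tau> + 1 / k} \<Longrightarrow> u t = 1"
    by (rule admissible_boundary_arc[OF k w, folded \<tau>_def]) (rule that)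
  note adm = admissible_prepend_parabola[OF k w(1) d arc(1), folded q_def]
  let ?x = "\<lambda>t. if t < d then (w + b) / k + (w\<^sup>2 - (w + d - t)\<^sup>2) / 2 else x (t - d)"
  let ?y = "\<lambda>t. if t < d then w + d - t else y (t - d)"
  let ?u = "\<lambda>t. if t < d then - 1 else u (t - d)"
  have 1: "?u t = - 1" if "t \<in> {0..<d}" for t using that by simp
  have 2: "(?x t, ?y t) \<in> Gamma_line k b" if "t \<in> {d..d + \<tau>}" for t
    using arc(2)[of "t - d"] that by auto
  have 3: "?u t = k * ?y t" if "t \<in> {d..<d + \<tau>}" for t
    using arc(4)[of "t - d"] that by auto
  have 4: "?u t = 1" if "t \<in> {d + \<tau>..d + (\<tau> + 1 / k)}" for t
    using arc(5)[of "t - d"] that \<tau> by auto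
  have 5: "(?x d, ?y d) = ((w + b) / k, w)" using arc(1) by (simp add: admissible_iff_motion)
  have 6: "(?x (d + \<tau>), ?y (d + \<tau>)) = point_C k b" using arc(3) \<tau> by simp
  have \<Gamma>: "?y t = k * ?x t - b" if "t \<in> {d<..<d + \<tau>}" for t
    using 2[of t] that by (simp add: Gamma_line_def)
  have ord: "d \<le> d + \<tau>" "d + \<tau> \<le> d + (\<tau> + 1 / k)" "d + \<tau> < d + (\<tau> + 1 / k)"
    using \<tau> k by auto
  have o: "optimal (constraint_set k b) q (d + (\<tau> + 1 / k)) ?x ?y ?u"
    by (rule three_leg_optimal(1)[OF adm d ord(1,2) ord(3) 1 \<Gamma> _ 4]) auto
  have uniq: "S = d + (\<tau> + 1 / k) \<and> (\<forall>t\<in>{0..d + (\<tau> + 1 / k)}. f t = ?x t \<and> g t = ?y t)"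
    if "optimal (constraint_set k b) q S f g h" for S f g h
    by (rule three_leg_optimal(2)[OF adm d ord(1,2) ord(3) 1 \<Gamma> _ 4 that]) auto
  show thesis by (rule that[OF o 1 5 2 3 6 4 uniq])
qed

lemma constrained_optimal_exists:
  assumes "k > 0" "b = 3 / (2 * k)" "- 1 < k * w" "w < 0" "0 \<le> d"
  shows "\<exists>x y u. optimal (constraint_set k b) ((w + b) / k + (w\<^sup>2 - (w + d)\<^sup>2) / 2, w + d)
    (d + (boundary_time k w + 1 / k)) x y u"
  by (rule constrained_synthesis[OF assms]) (intro exI)

lemma AE_leg_control:
  assumes m: "motion 0 T x y u" and mh: "motion 0 T xh yh uh"
    and eq: "\<And>t. t \<in> {0..T} \<Longrightarrow> y t = yh t"
    and sub: "0 \<le> c" "d \<le> T" and uh: "\<And>t. t \<in> {c..<d} \<Longrightarrow> uh t = v t"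
  shows "AE t in lebesgue_on {c..d}. u t = v t"
proof -
  have "negligible ({t \<in> {0..T}. u t \<noteq> uh t} \<union> {d})"
    using motion_controls_eq[OF m mh eq] by simp
  then have "negligible {t \<in> {c..d}. \<not> u t = v t}"
    by (rule negligible_subset) (use sub uh in force)
  then show ?thesis by (simp add: AE_lebesgue_on_iff_negligible)
qed

lemma constrained_optimal_type:
  assumes k: "k > 0" "b = 3 / (2 * k)" and w: "- 1 < k * w" "w < 0" and d: "0 < d"
    and q: "q = ((w + b) / k + (w\<^sup>2 - (w + d)\<^sup>2) / 2, w + d)"
  shows "\<exists>T x y u. optimal (constraint_set k b) q T x y u"
    and "optimal (constraint_set k b) q T x y u \<Longrightarrow> type_N'NCO k b T x y u"
proof -
  define \<tau> where "\<tau> = boundary_time k w"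
  have \<tau>: "0 < \<tau>" using boundary_time_reaches_C(1)[OF k(1) w] by (simp add: \<tau>_def)
  obtain xh yh uh where oh: "optimal (constraint_set k b) q (d + (\<tau> + 1 / k)) xh yh uh"
    and legs: "\<And>t. t \<in> {0..<d} \<Longrightarrow> uh t = - 1" "(xh d, yh d) = ((w + b) / k, w)"
    "\<And>t. t \<in> {d..d + \<tau>} \<Longrightarrow> (xh t, yh t) \<in> Gamma_line k b"
    "\<And>t. t \<in> {d..<d + \<tau>} \<Longrightarrow> uh t = k * yh t"
    "(xh (d + \<tau>), yh (d + \<tau>)) = point_C k b"
    "\<And>t. t \<in> {d + \<tau>..d + (\<tau> + 1 / k)} \<Longrightarrow> uh t = 1"
    and unique: "\<And>S f g h. optimal (constraint_set k b) q S f g h \<Longrightarrow>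
       S = d + (\<tau> + 1 / k) \<and> (\<forall>t\<in>{0..d + (\<tau> + 1 / k)}. f t = xh t \<and> g t = yh t)"
    by (rule constrained_synthesis[OF k w less_imp_le[OF d], folded q \<tau>_def]) (rule that)
  show "\<exists>T x y u. optimal (constraint_set k b) q T x y u" using oh by blast
  assume o: "optimal (constraint_set k b) q T x y u"
  from unique[OF o] have T: "T = d + (\<tau> + 1 / k)"
    and eq: "\<And>t. t \<in> {0..T} \<Longrightarrow> x t = xh t" "\<And>t. t \<in> {0..T} \<Longrightarrow> y t = yh t" by auto
  have m: "motion 0 T x y u" "motion 0 T xh yh uh"
    using o oh T by (auto simp: optimal_def admissible_iff_motion)
  note leg = AE_leg_control[OF m eq(2)]
  have ord: "0 \<le> d" "d \<le> d + \<tau>" "d + \<tau> < T" "d \<le> T" using T d \<tau> k by auto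
  show "type_N'NCO k b T x y u"
    unfolding type_N'NCO_def first_leg_def
  proof (rule exI[of _ d], rule exI[of _ "d + \<tau>"], intro conjI ballI)
    show "AE t in lebesgue_on {0..d}. u t = - 1"
      by (rule leg) (use legs(1) ord in auto)
    show "(x d, y d) \<in> open_segment (point_C k b) (point_E k b)"
      using eq[of d] ord legs(2) w by (simp add: mem_open_segment_CE_iff[OF k])
    show "(x t, y t) \<in> Gamma_line k b" if "t \<in> {d..d + \<tau>}" for t
      using eq[of t] legs(3)[OF that] ord that by auto
    have "AE t in lebesgue_on {d..d + \<tau>}. u t = k * yh t"
      by (rule leg) (use legs(4) ord in auto)
    moreover have "AE t in lebesgue_on {d..d + \<tau>}. y t = yh t"
      by (rule AE_I2) (use eq(2) ord in auto)
    ultimately show "AE t in lebesgue_on {d..d + \<tau>}. u t = k * y t" by eventually_elim simp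
    show "(x (d + \<tau>), y (d + \<tau>)) = point_C k b"
      using eq[of "d + \<tau>"] ord legs(5) by simp
    show "AE t in lebesgue_on {d + \<tau>..T}. u t = 1"
      by (rule leg) (use legs(6) ord T in auto)
  qed (use d \<tau> ord in auto)
qed

section \<open>Starting points in the interior of \<open>W2\<close>\<close>

lemma interior_W2_strict:
  assumes k: "k > 0" "b = 3 / (2 * k)" and p: "(x, y) \<in> interior (W2 k b)"
  shows "- 1 < k * y" "1 < k\<^sup>2 * (x + y\<^sup>2 / 2)" "y \<ge> 0 \<Longrightarrow> k\<^sup>2 * (x + y\<^sup>2 / 2) < 3 / 2"
    "y < 0 \<Longrightarrow> k\<^sup>2 * x < k * y + 3 / 2"
proof -
  obtain e where e: "e > 0" "ball (x, y) e \<subseteq> W2 k b"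
    using p by (auto simp: mem_interior)
  have near: "(x + r, y + s) \<in> W2 k b" if "\<bar>r\<bar> + \<bar>s\<bar> < e" for r s
  proof -
    have "dist (x, y) (x + r, y + s) \<le> \<bar>r\<bar> + \<bar>s\<bar>"
      using sqrt_sum_squares_le_sum_abs[of r s] by (simp add: dist_Pair_Pair dist_real_def)
    then show ?thesis using e(2) that by auto
  qed
  have a: "(x + e / 2, y) \<in> W2 k b" "(x - e / 2, y) \<in> W2 k b" "(x, y - e / 2) \<in> W2 k b"
    using near[of "e / 2" 0] near[of "- e / 2" 0] near[of 0 "- e / 2"] e(1) by auto
  have m: "m_const k b = 1 / k\<^sup>2" and bk: "b / k = 3 / 2 / k\<^sup>2"
    using k by (simp_all add: m_const_def power2_eq_square)
  have "- 1 / k < y" using a(3) e(1) by (auto simp: W2_def)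
  then show "- 1 < k * y" using k by (simp add: field_simps)
  have "1 / k\<^sup>2 < x + y\<^sup>2 / 2" using a(2) e(1) by (auto simp: W2_def m)
  then show "1 < k\<^sup>2 * (x + y\<^sup>2 / 2)" using k by (simp add: field_simps)
  show "k\<^sup>2 * (x + y\<^sup>2 / 2) < 3 / 2" if "y \<ge> 0"
  proof -
    have "x + y\<^sup>2 / 2 < 3 / 2 / k\<^sup>2" using a(1) e(1) that by (auto simp: W2_def bk)
    then show ?thesis using k by (simp add: field_simps)
  qed
  show "k\<^sup>2 * x < k * y + 3 / 2" if "y < 0"
  proof -
    have "x < (y + b) / k" using a(1) e(1) that by (auto simp: W2_def)
    then have "k\<^sup>2 * x < k\<^sup>2 * ((y + b) / k)"
      using k(1) by (simp only: mult_less_cancel_left_pos zero_less_power)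
    then show ?thesis by (simp only: boundary_rescaled[OF k])
  qed
qed

text \<open>The ordinate \<open>w\<close> of the hitting point is the larger root of \<open>(kw + 1)\<^sup>2 = D\<close>, where
  \<open>D = 2(k\<^sup>2c - 1)\<close> and \<open>c = x + y\<^sup>2/2\<close> is constant along the motion with \<open>u = -1\<close>. The three inequalities
  for \<open>D\<close> say that the start lies outside the tangent parabola, above \<open>\<Gamma>\<close>, and inside the parabola
  through \<open>E\<close>.\<close>

lemma interior_W2_reaches_Gamma:
  assumes k: "k > 0" "b = 3 / (2 * k)" and p: "p \<in> interior (W2 k b)"
  obtains w d where "- 1 < k * w" "w < 0" "0 < d" "p = ((w + b) / k + (w\<^sup>2 - (w + d)\<^sup>2) / 2, w + d)"
proof -
  obtain x y where xy: "p = (x, y)" by (cases p)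
  note strict = interior_W2_strict[OF k p[unfolded xy]]
  define D where "D = 2 * (k\<^sup>2 * (x + y\<^sup>2 / 2) - 1)"
  define w where "w = (sqrt D - 1) / k"
  have D: "0 < D" "D < (k * y + 1)\<^sup>2" "D < 1"
  proof -
    show "0 < D" using strict(2) by (simp add: D_def)
    have "D < 1 \<and> D < (k * y + 1)\<^sup>2"
    proof (cases "y \<ge> 0")
      case True
      then have "1 \<le> (k * y + 1)\<^sup>2" using k by (intro one_le_power) simp
      moreover have "D < 1" using strict(3)[OF True] by (simp add: D_def)
      ultimately show ?thesis by simp
    next
      case False
      have "D < (k * y + 1)\<^sup>2"
        using strict(4) False by (simp add: D_def power2_eq_square algebra_simps)
      moreover have "(k * y + 1)\<^sup>2 \<le> 1"
        using False strict(1) k by (intro power_le_one) (auto simp: mult_nonneg_nonpos)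
      ultimately show ?thesis by simp
    qed
    then show "D < (k * y + 1)\<^sup>2" "D < 1" by auto
  qed
  have kw: "k * w + 1 = sqrt D" using k by (simp add: w_def)
  have "sqrt D < 1" using D by simp
  have "sqrt D < k * y + 1" using D strict(1) by (intro real_less_lsqrt) auto
  then have "k * w < k * y" using kw by simp
  then have "w < y" using k by simp
  have "k\<^sup>2 * ((w + b) / k + (w\<^sup>2 - y\<^sup>2) / 2) = ((k * w + 1)\<^sup>2 - (k * y)\<^sup>2) / 2 + 1"
    using k by (simp add: power2_eq_square field_simps)
  also have "\<dots> = k\<^sup>2 * x"
  proof -
    have "(k * w + 1)\<^sup>2 = D" using D(1) kw by simp
    then show ?thesis by (simp add: D_def power2_eq_square field_simps)
  qed
  finally have "x = (w + b) / k + (w\<^sup>2 - y\<^sup>2) / 2" using k by simp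
  moreover have "- 1 < k * w" using kw real_sqrt_gt_zero[OF D(1)] by linarith
  moreover have "w < 0" using \<open>sqrt D < 1\<close> k by (simp add: w_def divide_simps)
  ultimately show thesis using \<open>w < y\<close> by (intro that[of w "y - w"]) (auto simp: xy)
qed

section \<open>Starting points on the segment \<open>CE\<close>\<close>

text \<open>Going backward with \<open>u = -1\<close> from a point of the open segment \<open>CE\<close> leads into the interior of
  \<open>W2\<close>. Halving the ordinate is a concrete choice that keeps it negative.\<close>

lemma backward_point_in_interior_W2:
  assumes k: "k > 0" "b = 3 / (2 * k)" and w: "- 1 < k * w" "w < 0"
  shows "((w + b) / k + (w\<^sup>2 - (w / 2)\<^sup>2) / 2, w / 2) \<in> interior (W2 k b)" (is "?q \<in> _")
proof -
  \<comment> \<open>An open part of \<open>W2\<close>, lying below the axis \<open>y = 0\<close>.\<close>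
  let ?U = "{(x, y). - 1 < k * y \<and> y < 0 \<and> 1 < k\<^sup>2 * (x + y\<^sup>2 / 2) \<and> k\<^sup>2 * x < k * y + 3 / 2}"
  have "?U \<subseteq> W2 k b"
  proof clarify
    fix x y :: real assume a: "- 1 < k * y" "y < 0" "1 < k\<^sup>2 * (x + y\<^sup>2 / 2)" "k\<^sup>2 * x < k * y + 3 / 2"
    have m: "m_const k b = 1 / k\<^sup>2" using k by (simp add: m_const_def)
    have "k\<^sup>2 * x < k\<^sup>2 * ((y + b) / k)" using a(4) by (simp only: boundary_rescaled[OF k])
    then have "x < (y + b) / k" using k(1) by (simp only: mult_less_cancel_left_pos zero_less_power)
    moreover have "1 / k\<^sup>2 < x + y\<^sup>2 / 2" using a(3) k by (simp add: field_simps)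
    moreover have "- 1 / k < y" using a(1) k by (simp add: field_simps)
    ultimately show "(x, y) \<in> W2 k b" using a(2) by (auto simp: W2_def m)
  qed
  moreover have "open ?U"
    unfolding case_prod_unfold by (intro open_Collect_conj open_Collect_less continuous_intros) simp_all
  moreover have "?q \<in> ?U"
  proof -
    have "k * w < 0" using k w by (simp add: mult_pos_neg)
    have 1: "k\<^sup>2 * ((w + b) / k + (w\<^sup>2 - (w / 2)\<^sup>2) / 2 + (w / 2)\<^sup>2 / 2) = (k * w + 1)\<^sup>2 / 2 + 1"
      using k by (simp add: power2_eq_square field_simps)
    have 2: "k\<^sup>2 * ((w + b) / k + (w\<^sup>2 - (w / 2)\<^sup>2) / 2) = k * w + 3 / 2 + 3 / 8 * (k * w)\<^sup>2"
      using k by (simp add: power2_eq_square field_simps)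
    have "(k * w) * (k * w + 1) < 0" using w \<open>k * w < 0\<close> by (simp add: mult_neg_pos)
    then have "3 / 8 * (k * w)\<^sup>2 < - (k * w / 2)"
      using \<open>k * w < 0\<close> by (simp add: power2_eq_square algebra_simps)
    moreover have "0 < (k * w + 1)\<^sup>2" using w by simp
    ultimately show ?thesis using w \<open>k * w < 0\<close> unfolding mem_Collect_eq prod.case 1 2 by simp
  qed
  ultimately show ?thesis by (meson interior_maximal subsetD)
qed

text \<open>Tails of optimal trajectories are optimal. Conversely, an optimal trajectory is prolonged backward
  into the interior of \<open>W2\<close>; the prolongation takes the same time as the three-leg trajectory from the new
  starting point, hence is optimal.\<close>

lemma CE_synthesis:
  assumes k: "k > 0" "b = 3 / (2 * k)" and p: "p \<in> open_segment (point_C k b) (point_E k b)"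
  shows "\<exists>T x y u. optimal (constraint_set k b) p T x y u"
    and "optimal (constraint_set k b) p T x y u \<longleftrightarrow>
      (x 0, y 0) = p \<and>
      (\<exists>q\<in>interior (W2 k b). \<exists>T' x' y' u' s.
         optimal (constraint_set k b) q T' x' y' u' \<and>
         (\<exists>t1. t1 < T' \<and> first_leg k b t1 x' y' u') \<and>
         is_tail s T' x' y' u' T x y u)" (is "_ \<longleftrightarrow> ?rhs")
proof -
  obtain w where pw: "p = ((w + b) / k, w)" and w: "- 1 < k * w" "w < 0"
    using p by (cases p) (auto simp: mem_open_segment_CE_iff[OF k])
  define \<tau> where "\<tau> = boundary_time k w"
  have \<tau>: "0 < \<tau>" using boundary_time_reaches_C(1)[OF k(1) w] by (simp add: \<tau>_def)
  obtain xh yh uh where "optimal (constraint_set k b) p (\<tau> + 1 / k) xh yh uh"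
    using constrained_optimal_exists[OF k w order_refl] by (simp add: pw \<tau>_def) blast
  then show "\<exists>T x y u. optimal (constraint_set k b) p T x y u" by blast
  show "optimal (constraint_set k b) p T x y u \<longleftrightarrow> ?rhs"
  proof
    assume ?rhs
    then show "optimal (constraint_set k b) p T x y u" using optimal_tail by blast
  next
    assume o: "optimal (constraint_set k b) p T x y u"
    have T: "T = \<tau> + 1 / k"
      using o \<open>optimal (constraint_set k b) p (\<tau> + 1 / k) xh yh uh\<close>
      unfolding optimal_def by (meson order_antisym)
    have adm: "admissible (constraint_set k b) ((w + b) / k, w) T x y u"
      using o by (simp add: optimal_def pw)
    then have start: "(x 0, y 0) = p" and "0 \<le> T" by (auto simp: admissible_iff_motion pw)
    define d where "d = - w / 2"
    have d: "0 < d" using w by (simp add: d_def)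
    define q where "q = ((w + b) / k + (w\<^sup>2 - (w + d)\<^sup>2) / 2, w + d)"
    have q: "q \<in> interior (W2 k b)"
      using backward_point_in_interior_W2[OF k w] by (simp add: q_def d_def)
    let ?x = "\<lambda>t. if t < d then (w + b) / k + (w\<^sup>2 - (w + d - t)\<^sup>2) / 2 else x (t - d)"
    let ?y = "\<lambda>t. if t < d then w + d - t else y (t - d)"
    let ?u = "\<lambda>t. if t < d then - 1 else u (t - d)"
    have "admissible (constraint_set k b) q (d + T) ?x ?y ?u"
      using admissible_prepend_parabola[OF k w(1) less_imp_le[OF d] adm] by (simp add: q_def)
    moreover obtain xq yq uq where "optimal (constraint_set k b) q (d + T) xq yq uq"
      using constrained_optimal_exists[OF k w less_imp_le[OF d], folded \<tau>_def q_def] unfolding T by blast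
    ultimately have oq: "optimal (constraint_set k b) q (d + T) ?x ?y ?u"
      by (auto simp: optimal_def)
    have "negligible {t \<in> {0..d}. \<not> ?u t = - 1}"
      by (rule negligible_subset[of "{d}"]) auto
    then have "first_leg k b d ?x ?y ?u"
      using d p start by (simp add: first_leg_def AE_lebesgue_on_iff_negligible)
    moreover have "d < d + T" unfolding T using \<tau> k(1) by (simp add: add_pos_pos)
    moreover have "is_tail d (d + T) ?x ?y ?u T x y u"
      using d \<open>0 \<le> T\<close> by (simp add: is_tail_def)
    ultimately show ?rhs using start q oq by blast
  qed
qed

section \<open>The optimal synthesis\<close>

lemma coincidence_imp_b_eq:
  assumes "k > 0" "b > 0" "point_C k b = point_A k b"
  shows "b = 3 / (2 * k)"
proof -
  have "- 1 / k = (1 - sqrt (2 * b * k + 1)) / k"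
    using assms(3) by (simp add: point_C_def point_A_def Let_def)
  then have "sqrt (2 * b * k + 1) = 2" using assms(1) by (simp add: field_simps)
  moreover have "0 \<le> 2 * b * k + 1" using assms by simp
  ultimately have "2 * b * k + 1 = 2\<^sup>2" using real_sqrt_pow2 by metis
  then show ?thesis using assms(1) by (simp add: field_simps)
qed

theorem theorem2:
  fixes k b :: real
  assumes "k > 0" and "b > 0"
    and "point_C k b = point_A k b" and "point_A k b = point_B k b"
  shows
    "(\<forall>p\<in>W1 k b.
        (\<exists>T x y u. optimal (constraint_set k b) p T x y u) \<and>
        (\<forall>T x y u. optimal (constraint_set k b) p T x y u \<longleftrightarrow> free_optimal p T x y u)) \<and>
     (\<forall>p\<in>interior (W2 k b).
        (\<exists>T x y u. optimal (constraint_set k b) p T x y u) \<and>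
        (\<forall>T x y u. optimal (constraint_set k b) p T x y u \<longrightarrow> type_N'NCO k b T x y u)) \<and>
     (\<forall>p\<in>open_segment (point_C k b) (point_E k b).
        (\<exists>T x y u. optimal (constraint_set k b) p T x y u) \<and>
        (\<forall>T x y u. optimal (constraint_set k b) p T x y u \<longleftrightarrow>
           (x 0, y 0) = p \<and>
           (\<exists>q\<in>interior (W2 k b). \<exists>T' x' y' u' s.
              optimal (constraint_set k b) q T' x' y' u' \<and>
              (\<exists>t1. t1 < T' \<and> first_leg k b t1 x' y' u') \<and>
              is_tail s T' x' y' u' T x y u)))"
proof -
  note k = assms(1) coincidence_imp_b_eq[OF assms(1-3)]
  show ?thesis
  proof (intro conjI ballI)
    fix p assume p: "p \<in> W1 k b"
    show "\<exists>T x y u. optimal (constraint_set k b) p T x y u" by (rule W1_synthesis(1)[OF k p])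
    show "\<forall>T x y u. optimal (constraint_set k b) p T x y u \<longleftrightarrow> free_optimal p T x y u"
      using W1_synthesis(2)[OF k p] by blast
  next
    fix p assume p: "p \<in> interior (W2 k b)"
    from interior_W2_reaches_Gamma[OF k p] obtain w d where "- 1 < k * w" "w < 0" "0 < d"
      "p = ((w + b) / k + (w\<^sup>2 - (w + d)\<^sup>2) / 2, w + d)" .
    note type = constrained_optimal_type[OF k this]
    show "\<exists>T x y u. optimal (constraint_set k b) p T x y u" by (rule type(1))
    show "\<forall>T x y u. optimal (constraint_set k b) p T x y u \<longrightarrow> type_N'NCO k b T x y u"
      using type(2) by blast
  next
    fix p assume p: "p \<in> open_segment (point_C k b) (point_E k b)"
    show "\<exists>T x y u. optimal (constraint_set k b) p T x y u" by (rule CE_synthesis(1)[OF k p])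
    show "\<forall>T x y u. optimal (constraint_set k b) p T x y u \<longleftrightarrow>
           (x 0, y 0) = p \<and>
           (\<exists>q\<in>interior (W2 k b). \<exists>T' x' y' u' s.
              optimal (constraint_set k b) q T' x' y' u' \<and>
              (\<exists>t1. t1 < T' \<and> first_leg k b t1 x' y' u') \<and>
              is_tail s T' x' y' u' T x y u)"
      by (intro allI CE_synthesis(2)[OF k p])
  qed
qed

end
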